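(* Let $\mathfrak H_1,\mathfrak H_2$ be Hilbert spaces, let $A\in[\mathfrak H_1]$ be selfadjoint, $B\in[\mathfrak H_1,\mathfrak H_2]$, $J_2=J_2^*=J_2^{-1}\in[\mathfrak H_2]$, and assume that $\nu_-(A)=\nu_-(J_2)<\infty$. Then: (i) The inequality $A\ge B^*J_2B$ holds if and only if $B=C|A|^{1/2}$ for some $J$-contractive operator $C\in[\mathfrak H_A,\mathfrak H_2]$; in this case $C$ is unique and, in addition, $J$-bicontractive, i.e., $J_A-C^*J_2C\ge0$ and $J_2-CJ_AC^*\ge0$. (ii) The equality $A=B^*J_2B$ holds if and only if $B=C|A|^{1/2}$ for some $J$-isometric operator $C\in[\mathfrak H_A,\mathfrak H_2]$; again $C$ is unique. In addition, $C$ is $J$-unitary if and only if $\operatorname{ran}B$ is dense in $\mathfrak H_2$.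
   Context: $[\mathfrak H,\mathfrak K]$ denotes the bounded everywhere defined linear operators from $\mathfrak H$ to $\mathfrak K$, $[\mathfrak H]=[\mathfrak H,\mathfrak H]$. For a bounded selfadjoint $X$, $\nu_-(X)$ is the dimension of its spectral subspace for $(-\infty,0)$, and $|X|=(X^2)^{1/2}$. With the polar decomposition $A=J_A|A|$, $J_A=\operatorname{sgn}(A)$ is a symmetry on $\overline{\operatorname{ran}}A$ and $\mathfrak H_A=(\overline{\operatorname{ran}}A,J_A)$ is the Kreĭn space on $\overline{\operatorname{ran}}A$ with fundamental symmetry $J_A$. An operator $C\in[\mathfrak H_A,\mathfrak H_2]$ is $J$-contractive if $J_A-C^*J_2C\ge0$, $J$-isometric if $C^*J_2C=J_A$, and $J$-unitary (unitary between the Kreĭn spaces $(\overline{\operatorname{ran}}A,J_A)$ and $(\mathfrak H_2,J_2)$) if $C^*J_2C=J_A$ and $CJ_AC^*=J_2$. Adjoints are Hilbert space adjoints. *)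

theory Defs
  imports "HOL-Analysis.Analysis" "HOL-Library.Extended_Nat"
begin

section \<open>Complex Hilbert spaces\<close>

text \<open>
  The library only has real inner product spaces. A complex inner product space is a real
  one with a compatible complex structure: the real inner product is the real part of the
  complex one, so norm, metric and topology are those of the library. The complex inner
  product is linear in its first argument.
\<close>

class complex_inner = real_inner +
  fixes scaleC :: "complex \<Rightarrow> 'a \<Rightarrow> 'a" (infixr "*\<^sub>C" 75)
    and cinner :: "'a \<Rightarrow> 'a \<Rightarrow> complex"
  assumes scaleC_add_right: "c *\<^sub>C (x + y) = c *\<^sub>C x + c *\<^sub>C y"
    and scaleC_add_left: "(c + d) *\<^sub>C x = c *\<^sub>C x + d *\<^sub>C x"
    and scaleC_scaleC: "c *\<^sub>C (d *\<^sub>C x) = (c * d) *\<^sub>C x"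
    and scaleC_of_real: "complex_of_real r *\<^sub>C x = r *\<^sub>R x"
    and cinner_commute: "cinner x y = cnj (cinner y x)"
    and cinner_add_left: "cinner (x + y) z = cinner x z + cinner y z"
    and cinner_scaleC_left: "cinner (c *\<^sub>C x) y = c * cinner x y"
    and inner_eq_Re_cinner: "x \<bullet> y = Re (cinner x y)"

class chilbert_space = complex_inner + complete_space

text \<open>
  Dimension of a complex subspace; all infinite dimensions are identified with \<open>\<infinity>\<close>.
\<close>

definition cdimension :: "'a::complex_inner set \<Rightarrow> enat" where
  "cdimension V =
     (if \<exists>S. finite S \<and> V \<subseteq> module.span scaleC S
      then enat (vector_space.dim scaleC V) else \<infinity>)"

section \<open>Bounded operators\<close>

text \<open>
  Bounded operators from the subspace \<open>M\<close> to the subspace \<open>N\<close>. They are \<open>undefined\<close>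
  outside \<open>M\<close>, so that equality of functions is equality of operators on \<open>M\<close>. For
  \<open>M = N = UNIV\<close> these are the bounded everywhere defined operators.
\<close>

definition bounded_ops ::
    "'a::complex_inner set \<Rightarrow> 'b::complex_inner set \<Rightarrow> ('a \<Rightarrow> 'b) set" where
  "bounded_ops M N = {T \<in> M \<rightarrow>\<^sub>E N.
     (\<forall>x\<in>M. \<forall>y\<in>M. T (x + y) = T x + T y) \<and>
     (\<forall>c. \<forall>x\<in>M. T (c *\<^sub>C x) = c *\<^sub>C T x) \<and>
     (\<exists>K. \<forall>x\<in>M. norm (T x) \<le> norm x * K)}"

lemma bounded_ops_UNIV:
  "T \<in> bounded_ops UNIV UNIV \<longleftrightarrow> bounded_linear T \<and> (\<forall>c x. T (c *\<^sub>C x) = c *\<^sub>C T x)"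
proof
  assume T: "T \<in> bounded_ops UNIV UNIV"
  have "T (r *\<^sub>R x) = r *\<^sub>R T x" for r x
    using T unfolding bounded_ops_def by (simp flip: scaleC_of_real)
  with T show "bounded_linear T \<and> (\<forall>c x. T (c *\<^sub>C x) = c *\<^sub>C T x)"
    unfolding bounded_ops_def by (auto intro!: bounded_linear.intro linearI bounded_linear_axioms.intro)
next
  assume "bounded_linear T \<and> (\<forall>c x. T (c *\<^sub>C x) = c *\<^sub>C T x)"
  then show "T \<in> bounded_ops UNIV UNIV"
    unfolding bounded_ops_def by (auto simp: linear_simps(1) dest: bounded_linear.bounded)
qed

text \<open>The Hilbert space adjoint of an operator defined on the closed subspace \<open>M\<close>.\<close>

definition cadjoint_on ::
    "'a::chilbert_space set \<Rightarrow> ('a \<Rightarrow> 'b::chilbert_space) \<Rightarrow> 'b \<Rightarrow> 'a" where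
  "cadjoint_on M T y = (THE z. z \<in> M \<and> (\<forall>x\<in>M. cinner (T x) y = cinner x z))"

abbreviation cadjoint :: "('a::chilbert_space \<Rightarrow> 'b::chilbert_space) \<Rightarrow> 'b \<Rightarrow> 'a" where
  "cadjoint \<equiv> cadjoint_on UNIV"

definition selfadjoint :: "('a::chilbert_space \<Rightarrow> 'a) \<Rightarrow> bool" where
  "selfadjoint T \<longleftrightarrow> T \<in> bounded_ops UNIV UNIV \<and> cadjoint T = T"

definition nonneg_on :: "'a::chilbert_space set \<Rightarrow> ('a \<Rightarrow> 'a) \<Rightarrow> bool" where
  "nonneg_on M T \<longleftrightarrow> (\<forall>x\<in>M. cinner (T x) x \<in> \<real>\<^sub>\<ge>\<^sub>0)"

text \<open>The square root of a nonnegative operator, and the modulus and sign of a selfadjoint one.\<close>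

definition op_sqrt :: "('a::chilbert_space \<Rightarrow> 'a) \<Rightarrow> 'a \<Rightarrow> 'a" where
  "op_sqrt T = (THE S. S \<in> bounded_ops UNIV UNIV \<and> nonneg_on UNIV S \<and> S \<circ> S = T)"

definition op_abs :: "('a::chilbert_space \<Rightarrow> 'a) \<Rightarrow> 'a \<Rightarrow> 'a" where
  "op_abs A = op_sqrt (A \<circ> A)"

abbreviation cran :: "('a::chilbert_space \<Rightarrow> 'b::chilbert_space) \<Rightarrow> 'b set" where
  "cran A \<equiv> closure (range A)"

text \<open>
  The polar decomposition \<open>A = J\<^sub>A \<bar>A\<bar>\<close>. Since the range of \<open>\<bar>A\<bar>\<close> is dense in
  \<open>cran A\<close>, this determines the operator \<open>J\<^sub>A\<close> on \<open>cran A\<close>.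
\<close>

definition op_sgn :: "('a::chilbert_space \<Rightarrow> 'a) \<Rightarrow> 'a \<Rightarrow> 'a" where
  "op_sgn A = (THE J. J \<in> bounded_ops (cran A) (cran A) \<and> A = J \<circ> op_abs A)"

section \<open>Spectral measures and the negative index\<close>

definition scalar_measure :: "(real set \<Rightarrow> 'a::chilbert_space \<Rightarrow> 'a) \<Rightarrow> 'a \<Rightarrow> real measure" where
  "scalar_measure E x = measure_of UNIV (sets borel) (\<lambda>S. ennreal (Re (cinner (E S x) x)))"

text \<open>
  \<open>E\<close> is the compactly supported projection-valued measure with \<open>A = \<integral> t dE(t)\<close>, the
  integral being taken weakly.
\<close>

definition spectral_measure ::
    "('a::chilbert_space \<Rightarrow> 'a) \<Rightarrow> (real set \<Rightarrow> 'a \<Rightarrow> 'a) \<Rightarrow> bool" where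
  "spectral_measure A E \<longleftrightarrow>
     (\<forall>S\<in>sets borel. selfadjoint (E S) \<and> E S \<circ> E S = E S) \<and>
     E UNIV = id \<and>
     (\<forall>F :: nat \<Rightarrow> real set. range F \<subseteq> sets borel \<longrightarrow> disjoint_family F \<longrightarrow>
        (\<forall>x. (\<lambda>n. E (F n) x) sums E (\<Union>n. F n) x)) \<and>
     (\<exists>r. E {-r..r} = id) \<and>
     (\<forall>x. has_bochner_integral (scalar_measure E x) complex_of_real (cinner (A x) x))"

text \<open>
  The dimension of the spectral subspace of \<open>A\<close> for \<open>(-\<infinity>, 0)\<close>. By the spectral theorem
  a bounded selfadjoint operator has exactly one spectral measure on the Borel sets, so the
  infimum is over a single number.
\<close>

definition nu_minus :: "('a::chilbert_space \<Rightarrow> 'a) \<Rightarrow> enat" where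
  "nu_minus A = (INF E\<in>{E. spectral_measure A E}. cdimension (range (E {..<0})))"

section \<open>Operators between Krein spaces\<close>

text \<open>
  Operators from the Krein space \<open>(M, J1)\<close> to the Krein space \<open>(UNIV, J2)\<close>, where \<open>M\<close> is
  a closed subspace of a Hilbert space.
\<close>

definition J_contractive ::
    "'a::chilbert_space set \<Rightarrow> ('a \<Rightarrow> 'a) \<Rightarrow> ('b::chilbert_space \<Rightarrow> 'b) \<Rightarrow> ('a \<Rightarrow> 'b) \<Rightarrow> bool" where
  "J_contractive M J1 J2 C \<longleftrightarrow>
     C \<in> bounded_ops M UNIV \<and> nonneg_on M (\<lambda>x. J1 x - cadjoint_on M C (J2 (C x)))"

definition J_bicontractive ::
    "'a::chilbert_space set \<Rightarrow> ('a \<Rightarrow> 'a) \<Rightarrow> ('b::chilbert_space \<Rightarrow> 'b) \<Rightarrow> ('a \<Rightarrow> 'b) \<Rightarrow> bool" where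
  "J_bicontractive M J1 J2 C \<longleftrightarrow>
     J_contractive M J1 J2 C \<and> nonneg_on UNIV (\<lambda>y. J2 y - C (J1 (cadjoint_on M C y)))"

definition J_isometric ::
    "'a::chilbert_space set \<Rightarrow> ('a \<Rightarrow> 'a) \<Rightarrow> ('b::chilbert_space \<Rightarrow> 'b) \<Rightarrow> ('a \<Rightarrow> 'b) \<Rightarrow> bool" where
  "J_isometric M J1 J2 C \<longleftrightarrow>
     C \<in> bounded_ops M UNIV \<and> (\<forall>x\<in>M. cadjoint_on M C (J2 (C x)) = J1 x)"

definition J_unitary ::
    "'a::chilbert_space set \<Rightarrow> ('a \<Rightarrow> 'a) \<Rightarrow> ('b::chilbert_space \<Rightarrow> 'b) \<Rightarrow> ('a \<Rightarrow> 'b) \<Rightarrow> bool" where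
  "J_unitary M J1 J2 C \<longleftrightarrow>
     J_isometric M J1 J2 C \<and> (\<forall>y. C (J1 (cadjoint_on M C y)) = J2 y)"

end

theory Submission
  imports Defs
begin

text \<open>
  Let \<open>P\<close> and \<open>Q\<close> be the spectral projections of \<open>A\<close> and \<open>J2\<close> for \<open>(-\<infinity>, 0)\<close>, and \<open>R = \<bar>A\<bar>\<^sup>1\<^sup>/\<^sup>2\<close>.
  They exist by finiteness of the indices, and \<open>\<bar>A\<bar> = A (1 - 2 P)\<close>, \<open>J\<^sub>A = 1 - 2 P\<close>,
  \<open>J2 = 1 - 2 Q\<close>. If \<open>B\<^sup>* J2 B \<le> A\<close> then \<open>Q B\<close> is injective on \<open>range P\<close>, so by equality of
  the dimensions it maps \<open>range P\<close> onto \<open>range Q\<close>. Hence for every \<open>x\<close> there is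
  \<open>l \<in> range P\<close> with \<open>Q B (x - l) = 0\<close>, and then
  \<open>\<parallel>B (x - l)\<parallel>\<^sup>2 \<le> (A (x - l), x - l) = \<parallel>R (x - P x)\<parallel>\<^sup>2 - \<parallel>R (P x - l)\<parallel>\<^sup>2\<close>. As \<open>R\<close> is bounded
  below on the finite-dimensional space \<open>range P\<close>, this bounds \<open>B x\<close> by a multiple of \<open>R x\<close>, and
  \<open>B\<close> factors through \<open>R\<close>. The same surjectivity, applied to \<open>C\<close>, gives
  bicontractivity by a Schur complement argument.
\<close>

section \<open>The complex inner product\<close>

text \<open>\<open>nu_minus\<close> is an infimum of extended naturals over spectral measures, and
  the infimum over the empty set is \<open>\<infinity>\<close>. A finite index therefore hands over
  a spectral measure, from which only the projection for \<open>(-\<infinity>, 0)\<close> is kept.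
  The obstacle is that the form of \<open>J2\<close> is indefinite:
  \<open>(J2 B x, B x) \<le> (A x, x)\<close> says nothing about the size of \<open>B x\<close> when
  its two parts balance. On the kernel of \<open>Q\<close> the form is the squared norm, and moving
  \<open>x\<close> by some \<open>l\<close> in \<open>range P\<close> is what brings
  \<open>B x\<close> there. The root \<open>R\<close> has to commute with \<open>P\<close>, so that
  \<open>A = R J R\<close> with \<open>J = 1 - 2 P\<close>; this is why the construction of square
  roots keeps track of commuting operators. The identity turns \<open>(A x, x)\<close> into
  \<open>(J R x, R x)\<close>, so contractivity and isometry of \<open>C\<close> can be checked on
  \<open>range R\<close> and extended to its closure by continuity.\<close>

instance chilbert_space \<subseteq> banach ..

interpretation complex_vector: vector_space "scaleC :: complex \<Rightarrow> 'a \<Rightarrow> 'a::complex_inner"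
  by unfold_locales (simp_all add: scaleC_add_right scaleC_add_left scaleC_scaleC
      scaleC_of_real[of 1, simplified])

interpretation complex_vector: vector_space_pair
  "scaleC :: complex \<Rightarrow> 'a \<Rightarrow> 'a::complex_inner" "scaleC :: complex \<Rightarrow> 'b \<Rightarrow> 'b::complex_inner"
  by unfold_locales

lemma cinner_add_right: "cinner x (y + z) = cinner x y + cinner x z"
  by (metis cinner_add_left cinner_commute complex_cnj_add)

lemma cinner_scaleC_right: "cinner x (c *\<^sub>C y) = cnj c * cinner x y"
  by (metis cinner_scaleC_left cinner_commute complex_cnj_mult)

lemma Im_cinner: "Im (cinner x y) = x \<bullet> (\<i> *\<^sub>C y)"
  by (simp add: inner_eq_Re_cinner cinner_scaleC_right)

lemma cinner_same: "cinner x x = of_real (x \<bullet> x)"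
  using cinner_commute[of x x] by (simp add: inner_eq_Re_cinner complex_eq_iff)

lemma norm_scaleC: "norm (c *\<^sub>C x) = cmod c * norm x"
proof -
  have "cinner (c *\<^sub>C x) (c *\<^sub>C x) = c * cnj c * cinner x x"
    by (simp add: cinner_scaleC_left cinner_scaleC_right mult.assoc)
  then have "complex_of_real ((norm (c *\<^sub>C x))\<^sup>2) = of_real ((cmod c * norm x)\<^sup>2)"
    unfolding cinner_same
    by (simp add: complex_mult_cnj cmod_power2 power_mult_distrib power2_norm_eq_inner)
  then show ?thesis
    by (simp add: power2_eq_iff_nonneg flip: of_real_power)
qed

lemma bounded_bilinear_cinner: "bounded_bilinear cinner"
proof
  fix x y :: 'a and r
  show "cinner (r *\<^sub>R x) y = r *\<^sub>R cinner x y" "cinner x (r *\<^sub>R y) = r *\<^sub>R cinner x y"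
    by (simp_all add: cinner_scaleC_left cinner_scaleC_right scaleR_conv_of_real flip: scaleC_of_real)
  show "\<exists>K. \<forall>x y. norm (cinner x y) \<le> norm (x::'a) * norm (y::'a) * K"
  proof (intro exI[of _ 2] allI)
    fix x y :: 'a
    have "\<bar>Re (cinner x y)\<bar> \<le> norm x * norm y"
      by (metis Cauchy_Schwarz_ineq2 inner_eq_Re_cinner)
    moreover have "\<bar>Im (cinner x y)\<bar> \<le> norm x * norm y"
      using Cauchy_Schwarz_ineq2[of x "\<i> *\<^sub>C y"] by (simp add: Im_cinner norm_scaleC)
    ultimately show "norm (cinner x y) \<le> norm x * norm y * 2"
      using cmod_le[of "cinner x y"] by simp
  qed
qed (simp_all add: cinner_add_left cinner_add_right)

interpretation cinner: bounded_bilinear cinner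
  by (rule bounded_bilinear_cinner)

declare cinner.zero_left [simp] cinner.zero_right [simp]

lemma bounded_linear_scaleC: "bounded_linear (\<lambda>x::'a::complex_inner. c *\<^sub>C x)"
  by (rule bounded_linear_intro[of _ "cmod c"])
    (simp_all add: scaleC_add_right scaleC_scaleC norm_scaleC mult.commute flip: scaleC_of_real)

text \<open>Testing against the multiple by \<open>\<i>\<close> recovers the imaginary part. In this
  way facts proved for the real inner product, such as Riesz representation, carry over to the
  complex one.\<close>

lemma cinner_eqI:
  assumes "\<And>c. (c *\<^sub>C x) \<bullet> y = (c *\<^sub>C x') \<bullet> y'"
  shows "cinner x y = cinner x' y'"
  using assms[of 1] assms[of \<i>]
  by (simp add: inner_eq_Re_cinner complex_eq_iff cinner_scaleC_left)

section \<open>Riesz representation and adjoints\<close>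

lemma nonneg_quadratic_linear_zero:
  fixes a b :: real
  assumes "\<And>t. 0 \<le> t * a + t\<^sup>2 * b" and "0 \<le> b"
  shows "a = 0"
proof -
  \<comment> \<open>The \<open>1\<close> in the denominator covers \<open>b = 0\<close>; at
    \<open>t = - s\<close> the quadratic equals \<open>- (s\<^sup>2)\<close>.\<close>
  define s where "s = a / (b + 1)"
  have a: "a = s * (b + 1)" using assms(2) by (simp add: s_def)
  have "0 \<le> (- s) * a + (- s)\<^sup>2 * b" by (rule assms(1))
  also have "\<dots> = - (s\<^sup>2)" unfolding a by algebra
  finally have "s = 0" by simp
  then show ?thesis by (simp add: a)
qed

text \<open>The representing vector minimises \<open>\<parallel>x\<parallel>\<^sup>2 - 2 \<phi> x\<close> on \<open>M\<close>.\<close>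

lemma riesz_representation:
  fixes M :: "'a::{real_inner,complete_space} set"
  assumes M: "closed M" "subspace M"
    and add: "\<And>x y. x \<in> M \<Longrightarrow> y \<in> M \<Longrightarrow> \<phi> (x + y) = \<phi> x + \<phi> y"
    and scale: "\<And>r x. x \<in> M \<Longrightarrow> \<phi> (r *\<^sub>R x) = r * \<phi> x"
    and bound: "\<And>x. x \<in> M \<Longrightarrow> \<bar>\<phi> x\<bar> \<le> norm x * K"
  obtains z where "z \<in> M" "\<And>x. x \<in> M \<Longrightarrow> \<phi> x = x \<bullet> z"
proof -
  have K: "norm x * K \<le> norm x * \<bar>K\<bar>" for x :: 'a
    by (simp add: mult_left_mono)
  define F where "F x = (norm x)\<^sup>2 - 2 * \<phi> x" for x
  have F_ge: "- (K\<^sup>2) \<le> F x" if "x \<in> M" for x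
    using bound[OF that] zero_le_power2[of "norm x - K"]
    unfolding F_def by (simp add: power2_diff)
  define d where "d = Inf (F ` M)"
  have bdd: "bdd_below (F ` M)"
    using F_ge by (auto simp: bdd_below_def)
  have ne: "M \<noteq> {}" using M(2) subspace_0 by blast
  have d_le: "d \<le> F x" if "x \<in> M" for x
    unfolding d_def using that bdd by (simp add: cInf_lower)
  have "\<exists>x\<in>M. F x < d + 1 / real (Suc n)" for n
    using cInf_less_iff[of "F ` M" "d + 1 / real (Suc n)"] ne bdd unfolding d_def by auto
  then obtain m where m: "\<And>n. m n \<in> M" "\<And>n. F (m n) < d + 1 / real (Suc n)"
    by metis
  \<comment> \<open>Parallelogram law: the linear terms of \<open>F\<close> cancel, and the midpoint
    lies in \<open>M\<close>, where \<open>F\<close> is at least \<open>d\<close>. Hence a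
    minimising sequence is Cauchy.\<close>
  have par: "(norm (x - y))\<^sup>2 \<le> 2 * F x + 2 * F y - 4 * d" if "x \<in> M" "y \<in> M" for x y
  proof -
    have mid: "(1/2) *\<^sub>R (x + y) \<in> M"
      using that M(2) by (simp add: subspace_add subspace_scale)
    have "(norm (x - y))\<^sup>2 = 2 * F x + 2 * F y - 4 * F ((1/2) *\<^sub>R (x + y))"
      using scale[of "x + y" "1/2"] add[of x y] that M(2) unfolding F_def
      by (simp add: subspace_add power2_norm_eq_inner inner_simps inner_commute algebra_simps)
    with d_le[OF mid] show ?thesis by simp
  qed
  have "Cauchy m"
  proof (rule metric_CauchyI)
    fix e :: real assume "0 < e"
    then obtain N where N: "1 / real (Suc N) < e\<^sup>2 / 4"
      using nat_approx_posE[of "e\<^sup>2 / 4"] by auto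
    have "dist (m i) (m j) < e" if "N \<le> i" "N \<le> j" for i j
    proof -
      have "1 / real (Suc i) \<le> 1 / real (Suc N)" "1 / real (Suc j) \<le> 1 / real (Suc N)"
        using that by (simp_all add: frac_le)
      then have "(norm (m i - m j))\<^sup>2 < e\<^sup>2"
        using par[OF m(1)[of i] m(1)[of j]] m(2)[of i] m(2)[of j] N by linarith
      then show ?thesis
        using \<open>0 < e\<close> by (simp add: dist_norm power_less_imp_less_base)
    qed
    then show "\<exists>N. \<forall>i\<ge>N. \<forall>j\<ge>N. dist (m i) (m j) < e" by blast
  qed
  then obtain z where z: "m \<longlonglongrightarrow> z"
    using Cauchy_convergent convergent_def by blast
  have zM: "z \<in> M" using closed_sequentially[OF M(1) _ z] m(1) by blast
  have \<phi>diff: "\<phi> (x - y) = \<phi> x - \<phi> y" if "x \<in> M" "y \<in> M" for x y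
    using add[of x "- y"] scale[of y "-1"] that M(2) by (simp add: subspace_neg)
  have "(\<lambda>n. \<phi> (m n) - \<phi> z) \<longlonglongrightarrow> 0"
  proof (rule Lim_null_comparison)
    show "\<forall>\<^sub>F n in sequentially. norm (\<phi> (m n) - \<phi> z) \<le> norm (m n - z) * \<bar>K\<bar>"
      using bound[of "m _ - z"] \<phi>diff[OF m(1) zM] K[of "m _ - z"] subspace_diff[OF M(2) m(1) zM]
      by (intro always_eventually allI) (metis order_trans real_norm_def)
    show "(\<lambda>n. norm (m n - z) * \<bar>K\<bar>) \<longlonglongrightarrow> 0"
      using z by (simp add: LIM_zero_iff tendsto_norm_zero tendsto_mult_left_zero)
  qed
  then have "(\<lambda>n. F (m n)) \<longlonglongrightarrow> F z"
    unfolding F_def using z by (intro tendsto_intros) (simp_all add: LIM_zero_iff)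
  moreover have "(\<lambda>n. F (m n)) \<longlonglongrightarrow> d"
  proof (rule real_tendsto_sandwich[where f = "\<lambda>_. d" and h = "\<lambda>n. d + 1 / real (Suc n)"])
    show "(\<lambda>n. d + 1 / real (Suc n)) \<longlonglongrightarrow> d"
      using tendsto_add[OF tendsto_const[of d] LIMSEQ_inverse_real_of_nat]
      by (simp add: divide_inverse)
  qed (use d_le m in \<open>auto intro!: always_eventually less_imp_le simp del: of_nat_Suc\<close>)
  ultimately have Fz: "F z = d" using LIMSEQ_unique by blast
  have "\<phi> x = x \<bullet> z" if "x \<in> M" for x
  proof -
    \<comment> \<open>\<open>F\<close> is minimal at \<open>z\<close>, so its increment along
      \<open>x\<close> is nonnegative, which forces the linear coefficient to vanish.\<close>
    have "0 \<le> t * (2 * (x \<bullet> z - \<phi> x)) + t\<^sup>2 * (norm x)\<^sup>2" for t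
    proof -
      have "F (z + t *\<^sub>R x) = F z + t * (2 * (x \<bullet> z - \<phi> x)) + t\<^sup>2 * (norm x)\<^sup>2"
        unfolding F_def using zM that M(2)
        by (simp add: add scale subspace_scale power2_norm_eq_inner inner_simps inner_commute
            algebra_simps) (simp add: power2_eq_square flip: dot_square_norm)
      with Fz d_le[of "z + t *\<^sub>R x"] zM that M(2) show ?thesis
        by (simp add: subspace_add subspace_scale)
    qed
    from nonneg_quadratic_linear_zero[OF this] show ?thesis by simp
  qed
  with zM that show thesis by blast
qed

lemma csubspace_imp_subspace:
  assumes "complex_vector.subspace M" shows "subspace M"
  using assms unfolding complex_vector.subspace_def subspace_def
  by (metis scaleC_of_real)

lemma bounded_opsD:
  assumes "T \<in> bounded_ops M N"
  shows "x \<in> M \<Longrightarrow> T x \<in> N" "x \<in> M \<Longrightarrow> y \<in> M \<Longrightarrow> T (x + y) = T x + T y"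
    "x \<in> M \<Longrightarrow> T (c *\<^sub>C x) = c *\<^sub>C T x" "x \<in> M \<Longrightarrow> T (r *\<^sub>R x) = r *\<^sub>R T x"
    "x \<notin> M \<Longrightarrow> T x = undefined"
  using assms unfolding bounded_ops_def by (auto simp: PiE_def extensional_def simp flip: scaleC_of_real)

lemma bounded_ops_diff:
  assumes "T \<in> bounded_ops M N" "complex_vector.subspace M" "x \<in> M" "y \<in> M"
  shows "T (x - y) = T x - T y"
  using bounded_opsD(2)[OF assms(1), of x "- y"] bounded_opsD(4)[OF assms(1), of y "- 1"] assms
  by (simp add: complex_vector.subspace_neg)

lemma bounded_ops_bound:
  assumes "T \<in> bounded_ops M N"
  obtains K where "0 < K" "\<And>x. x \<in> M \<Longrightarrow> norm (T x) \<le> norm x * K"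
proof -
  obtain K where K: "\<And>x. x \<in> M \<Longrightarrow> norm (T x) \<le> norm x * K"
    using assms unfolding bounded_ops_def by blast
  have "norm (T x) \<le> norm x * (\<bar>K\<bar> + 1)" if "x \<in> M" for x
  proof -
    have "norm x * K \<le> norm x * (\<bar>K\<bar> + 1)" by (intro mult_left_mono) auto
    with K[OF that] show ?thesis by linarith
  qed
  then show thesis using that[of "\<bar>K\<bar> + 1"] by simp
qed

lemma bounded_ops_continuous_on:
  assumes T: "T \<in> bounded_ops M N" and M: "complex_vector.subspace M"
  shows "continuous_on M T"
proof -
  obtain K where K: "0 < K" "\<And>x. x \<in> M \<Longrightarrow> norm (T x) \<le> norm x * K"
    using bounded_ops_bound[OF T] by metis
  have "K-lipschitz_on M T"
    using K M by (intro lipschitz_onI)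
      (auto simp: dist_norm mult.commute complex_vector.subspace_diff simp flip: bounded_ops_diff[OF T M])
  then show ?thesis by (rule lipschitz_on_continuous_on)
qed

lemma cadjoint_on_ex:
  fixes T :: "'a::chilbert_space \<Rightarrow> 'b::chilbert_space"
  assumes M: "closed M" "complex_vector.subspace M" and T: "T \<in> bounded_ops M N"
  obtains z where "z \<in> M" "\<And>x. x \<in> M \<Longrightarrow> cinner (T x) y = cinner x z"
proof -
  obtain K where K: "\<And>x. x \<in> M \<Longrightarrow> norm (T x) \<le> norm x * K"
    using bounded_ops_bound[OF T] by metis
  have bnd: "\<bar>T x \<bullet> y\<bar> \<le> norm x * (K * norm y)" if "x \<in> M" for x
    using Cauchy_Schwarz_ineq2[of "T x" y] mult_right_mono[OF K[OF that], of "norm y"]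
    by (simp add: mult.assoc)
  obtain z where z: "z \<in> M" "\<And>x. x \<in> M \<Longrightarrow> T x \<bullet> y = x \<bullet> z"
  proof (rule riesz_representation[OF M(1) csubspace_imp_subspace[OF M(2)]])
    show "\<bar>T x \<bullet> y\<bar> \<le> norm x * (K * norm y)" if "x \<in> M" for x
      by (rule bnd[OF that])
  qed (auto simp: bounded_opsD[OF T] inner_add_left)
  have "cinner (T x) y = cinner x z" if "x \<in> M" for x
    by (rule cinner_eqI)
      (metis z(2) bounded_opsD(3)[OF T that] complex_vector.subspace_scale[OF M(2) that])
  with z(1) that show thesis by blast
qed

lemma cinner_ortho_zero:
  assumes "complex_vector.subspace M" "z \<in> M" "z' \<in> M" "\<And>x. x \<in> M \<Longrightarrow> cinner x z = cinner x z'"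
  shows "z = z'"
  using assms(4)[OF complex_vector.subspace_diff[OF assms(1-3)]]
  by (metis cinner.diff_right cinner_same inner_eq_zero_iff of_real_eq_0_iff right_minus_eq)

lemma cadjoint_on_eqI:
  assumes "complex_vector.subspace M" "z \<in> M" "\<And>x. x \<in> M \<Longrightarrow> cinner (T x) y = cinner x z"
  shows "cadjoint_on M T y = z"
  unfolding cadjoint_on_def using assms cinner_ortho_zero[OF assms(1) _ assms(2)]
  by (intro the_equality) auto

lemma cadjoint_on:
  fixes T :: "'a::chilbert_space \<Rightarrow> 'b::chilbert_space"
  assumes M: "closed M" "complex_vector.subspace M" and T: "T \<in> bounded_ops M N"
  shows "cadjoint_on M T y \<in> M" "x \<in> M \<Longrightarrow> cinner x (cadjoint_on M T y) = cinner (T x) y"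
    "x \<in> M \<Longrightarrow> cinner (cadjoint_on M T y) x = cinner y (T x)"
proof -
  obtain z where z: "z \<in> M" "\<And>x. x \<in> M \<Longrightarrow> cinner (T x) y = cinner x z"
    using cadjoint_on_ex[OF M T] by metis
  then have eq: "cadjoint_on M T y = z"
    using cadjoint_on_eqI[OF M(2)] by metis
  show "cadjoint_on M T y \<in> M" "x \<in> M \<Longrightarrow> cinner x (cadjoint_on M T y) = cinner (T x) y"
    using z by (simp_all add: eq)
  then show "x \<in> M \<Longrightarrow> cinner (cadjoint_on M T y) x = cinner y (T x)"
    by (metis cinner_commute)
qed

lemma cadjoint:
  fixes T :: "'a::chilbert_space \<Rightarrow> 'b::chilbert_space"
  assumes "T \<in> bounded_ops UNIV UNIV"
  shows "cinner x (cadjoint T y) = cinner (T x) y" "cinner (cadjoint T y) x = cinner y (T x)"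
  using cadjoint_on(2,3)[OF closed_UNIV complex_vector.subspace_UNIV assms] by auto

lemma selfadjoint_iff:
  "selfadjoint T \<longleftrightarrow> T \<in> bounded_ops UNIV UNIV \<and> (\<forall>x y. cinner (T x) y = cinner x (T y))"
  unfolding selfadjoint_def
  using cadjoint(1) cadjoint_on_eqI[OF complex_vector.subspace_UNIV, of _ T]
  by (metis UNIV_I ext)

lemma bounded_ops_linear:
  assumes "T \<in> bounded_ops UNIV UNIV"
  shows "bounded_linear T" "T (x + y) = T x + T y" "T (x - y) = T x - T y" "T (- x) = - T x" "T 0 = 0"
    "T (r *\<^sub>R x) = r *\<^sub>R T x" "T (c *\<^sub>C x) = c *\<^sub>C T x"
proof -
  show "bounded_linear T" using assms bounded_ops_UNIV by blast
  from linear_simps[OF this]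
  show "T (x + y) = T x + T y" "T (x - y) = T x - T y" "T (- x) = - T x" "T 0 = 0"
    "T (r *\<^sub>R x) = r *\<^sub>R T x"
    by auto
  show "T (c *\<^sub>C x) = c *\<^sub>C T x" using bounded_opsD[OF assms] by simp
qed

lemma selfadjointD:
  assumes "selfadjoint T"
  shows "T \<in> bounded_ops UNIV UNIV" "cinner (T x) y = cinner x (T y)" "T x \<bullet> y = x \<bullet> T y"
    "cinner (T x) x = of_real (T x \<bullet> x)"
proof -
  show T: "T \<in> bounded_ops UNIV UNIV" and *: "cinner (T x) y = cinner x (T y)" for x y
    using assms by (auto simp: selfadjoint_iff)
  then show "T x \<bullet> y = x \<bullet> T y" by (simp add: inner_eq_Re_cinner)
  have "Im (cinner (T x) x) = 0"
    using *[of x x] cinner_commute[of "T x" x] by (simp add: complex_eq_iff)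
  then show "cinner (T x) x = of_real (T x \<bullet> x)"
    by (simp add: complex_eq_iff inner_eq_Re_cinner)
qed

lemma orthogonal_decomposition:
  fixes M :: "'a::chilbert_space set"
  assumes M: "closed M" "complex_vector.subspace M"
  obtains m where "m \<in> M" "\<And>y. y \<in> M \<Longrightarrow> cinner y (x - m) = 0"
proof -
  \<comment> \<open>The adjoint of the inclusion of \<open>M\<close> is the orthogonal projection
    onto \<open>M\<close>.\<close>
  have "restrict id M \<in> bounded_ops M UNIV"
    using M(2) unfolding bounded_ops_def
    by (auto simp: complex_vector.subspace_add complex_vector.subspace_scale intro!: exI[of _ 1])
  from cadjoint_on_ex[OF M this, of x] that show thesis
    by (metis cinner.diff_right diff_self id_apply restrict_apply')
qed

section \<open>Square roots\<close>

text \<open>Roots are built in the real structure alone. Complex linearity of a root is recovered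
  later from its commuting with the complex scalars.\<close>

definition symmetric_op :: "('a::real_inner \<Rightarrow> 'a) \<Rightarrow> bool" where
  "symmetric_op T \<longleftrightarrow> bounded_linear T \<and> (\<forall>x y. T x \<bullet> y = x \<bullet> T y)"

definition positive_op :: "('a::real_inner \<Rightarrow> 'a) \<Rightarrow> bool" where
  "positive_op T \<longleftrightarrow> symmetric_op T \<and> (\<forall>x. 0 \<le> T x \<bullet> x)"

lemma positive_op_Cauchy_Schwarz:
  assumes "positive_op T"
  shows "(T x \<bullet> y)\<^sup>2 \<le> (T x \<bullet> x) * (T y \<bullet> y)"
proof -
  have lin: "bounded_linear T" and sym: "\<And>x y. T x \<bullet> y = x \<bullet> T y" and pos: "\<And>x. 0 \<le> T x \<bullet> x"
    using assms by (auto simp: positive_op_def symmetric_op_def)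
  let ?a = "T x \<bullet> x" and ?b = "T x \<bullet> y" and ?c = "T y \<bullet> y"
  have expand: "T (x + t *\<^sub>R y) \<bullet> (x + t *\<^sub>R y) = ?a + t * (2 * ?b) + t\<^sup>2 * ?c" for t
    using sym[of y x]
    by (simp add: linear_simps[OF lin] inner_simps inner_commute
        algebra_simps power2_eq_square)
  have q: "0 \<le> ?a + t * (2 * ?b) + t\<^sup>2 * ?c" for t
    using pos[of "x + t *\<^sub>R y"] by (simp add: expand)
  show ?thesis
  proof (cases "?c = 0")
    case True
    have "?b = 0"
    proof (rule ccontr)
      assume "?b \<noteq> 0"
      \<comment> \<open>With \<open>?c = 0\<close> the polynomial is affine in \<open>t\<close>;
        this \<open>t\<close> gives it the value \<open>-1\<close>.\<close>
      then show False using q[of "- (?a + 1) / (2 * ?b)"] True by (simp add: field_simps)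
    qed
    with True show ?thesis by simp
  next
    case False
    with pos[of y] have c: "0 < ?c" by simp
    have "0 \<le> (?a + (- ?b / ?c) * (2 * ?b) + (- ?b / ?c)\<^sup>2 * ?c) * ?c"
      using q[of "- ?b / ?c"] c by (intro mult_nonneg_nonneg) auto
    also have "\<dots> = ?a * ?c - ?b\<^sup>2"
      using c by (simp add: power2_eq_square) (simp add: field_simps)
    finally show ?thesis by simp
  qed
qed

text \<open>Cauchy-Schwarz for the form of \<open>T\<close> with \<open>y = T x\<close>, after which
  one factor \<open>(norm (T x))\<^sup>2\<close> cancels. It makes \<open>1 - T / K\<close> a
  contraction.\<close>

lemma positive_op_norm_le:
  assumes "positive_op T" "\<And>x. norm (T x) \<le> K * norm x"
  shows "(norm (T x))\<^sup>2 \<le> K * (T x \<bullet> x)"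
proof (cases "T x = 0")
  case False
  have pos: "0 \<le> T x \<bullet> x" using assms(1) by (simp add: positive_op_def)
  have "((norm (T x))\<^sup>2)\<^sup>2 \<le> (T x \<bullet> x) * (T (T x) \<bullet> T x)"
    using positive_op_Cauchy_Schwarz[OF assms(1), of x "T x"] by (simp add: power2_norm_eq_inner)
  also have "\<dots> \<le> (T x \<bullet> x) * (K * norm (T x) * norm (T x))"
  proof (rule mult_left_mono[OF _ pos])
    have "T (T x) \<bullet> T x \<le> norm (T (T x)) * norm (T x)" by (rule norm_cauchy_schwarz)
    also have "\<dots> \<le> K * norm (T x) * norm (T x)"
      using assms(2)[of "T x"] by (rule mult_right_mono) simp
    finally show "T (T x) \<bullet> T x \<le> K * norm (T x) * norm (T x)" .
  qed
  finally have "(norm (T x))\<^sup>2 * (norm (T x))\<^sup>2 \<le> (K * (T x \<bullet> x)) * (norm (T x))\<^sup>2"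
    by (simp only: power2_eq_square mult_ac)
  then show ?thesis by (rule mult_right_le_imp_le) (simp add: False)
qed (use assms in simp)

lemma positive_op_eq_0:
  assumes "positive_op T" "T x \<bullet> x = 0" shows "T x = 0"
  using positive_op_Cauchy_Schwarz[OF assms(1), of x "T x"] assms(2) by simp

section \<open>Existence of the root by iteration\<close>

text \<open>The scalar model of the iteration below: it increases and stays below the double root
  \<open>1\<close> of \<open>y = (1 + y^2) / 2\<close>. Comparison with it still works when
  \<open>X\<close> has norm exactly \<open>1\<close>, where the iteration need not be a strict
  contraction.\<close>

fun sqrt_majorant :: "nat \<Rightarrow> real" where
  "sqrt_majorant 0 = 0"
| "sqrt_majorant (Suc n) = (1 + (sqrt_majorant n)\<^sup>2) / 2"

lemma sqrt_majorant_bounds: "0 \<le> sqrt_majorant n \<and> sqrt_majorant n \<le> 1"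
proof (induction n)
  case (Suc n)
  then have "(sqrt_majorant n)\<^sup>2 \<le> 1" by (simp add: power_le_one)
  with Suc show ?case by simp
qed simp

lemma sqrt_majorant_mono: "sqrt_majorant n \<le> sqrt_majorant (Suc n)"
proof -
  have "0 \<le> (1 - sqrt_majorant n)\<^sup>2" by simp
  then show ?thesis by (simp add: power2_diff)
qed

text \<open>
  With \<open>X = 1 - T\<close> the solution of \<open>Y = (X + Y\<^sup>2) / 2\<close> obtained by iteration from \<open>0\<close>
  yields the root \<open>1 - Y\<close> of \<open>T\<close>. For \<open>\<parallel>X\<parallel> \<le> 1\<close> the increments of the iteration are
  bounded by those of the same iteration for the number \<open>1\<close>.
\<close>

fun sqrt_iter :: "('a \<Rightarrow>\<^sub>L 'a) \<Rightarrow> nat \<Rightarrow> ('a \<Rightarrow>\<^sub>L 'a::real_normed_vector)" where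
  "sqrt_iter X 0 = 0"
| "sqrt_iter X (Suc n) = (1/2) *\<^sub>R (X + (sqrt_iter X n o\<^sub>L sqrt_iter X n))"

lemma norm_sqrt_iter_le:
  assumes "norm X \<le> 1" shows "norm (sqrt_iter X n) \<le> sqrt_majorant n"
proof (induction n)
  case (Suc n)
  have "norm (X + (sqrt_iter X n o\<^sub>L sqrt_iter X n)) \<le> norm X + norm (sqrt_iter X n) * norm (sqrt_iter X n)"
    by (intro order_trans[OF norm_triangle_ineq] add_left_mono norm_blinfun_compose)
  also have "\<dots> \<le> 1 + (sqrt_majorant n)\<^sup>2"
    using assms Suc by (simp add: power2_eq_square add_mono mult_mono')
  finally show ?case by simp
qed simp

lemma norm_sqrt_iter_diff_le:
  assumes "norm X \<le> 1"
  shows "norm (sqrt_iter X (Suc n) - sqrt_iter X n) \<le> sqrt_majorant (Suc n) - sqrt_majorant n"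
proof (induction n)
  case 0
  show ?case using assms by simp
next
  case (Suc n)
  let ?Y = "sqrt_iter X" and ?y = sqrt_majorant
  have y: "0 \<le> ?y n" "0 \<le> ?y (Suc n)"
    using sqrt_majorant_bounds by blast+
  have "?Y (Suc (Suc n)) - ?Y (Suc n) = (1/2) *\<^sub>R ((?Y (Suc n) o\<^sub>L ?Y (Suc n)) - (?Y n o\<^sub>L ?Y n))"
    by (simp only: sqrt_iter.simps(2)[of X "Suc n"] sqrt_iter.simps(2)[of X n, symmetric])
      (simp add: algebra_simps)
  \<comment> \<open>This splitting of a difference of squares holds without commutativity.\<close>
  also have "(?Y (Suc n) o\<^sub>L ?Y (Suc n)) - (?Y n o\<^sub>L ?Y n) =
      (?Y (Suc n) o\<^sub>L (?Y (Suc n) - ?Y n)) + ((?Y (Suc n) - ?Y n) o\<^sub>L ?Y n)"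
    by (simp only: bounded_bilinear.diff_left[OF bounded_bilinear_blinfun_compose]
        bounded_bilinear.diff_right[OF bounded_bilinear_blinfun_compose]) simp
  finally have "norm (?Y (Suc (Suc n)) - ?Y (Suc n)) \<le>
      (norm (?Y (Suc n)) * norm (?Y (Suc n) - ?Y n) + norm (?Y (Suc n) - ?Y n) * norm (?Y n)) / 2"
    by (simp only: norm_scaleR)
      (simp del: sqrt_iter.simps, intro order_trans[OF norm_triangle_ineq] add_mono norm_blinfun_compose)
  also have "\<dots> \<le> (?y (Suc n) * (?y (Suc n) - ?y n) + (?y (Suc n) - ?y n) * ?y n) / 2"
    using Suc norm_sqrt_iter_le[OF assms, of n] norm_sqrt_iter_le[OF assms, of "Suc n"] y
      sqrt_majorant_mono[of n]
    by (intro divide_right_mono add_mono mult_mono) (auto simp del: sqrt_iter.simps sqrt_majorant.simps)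
  also have "\<dots> = ((?y (Suc n))\<^sup>2 - (?y n)\<^sup>2) / 2"
    by (simp add: power2_eq_square algebra_simps del: sqrt_majorant.simps)
  also have "\<dots> = ?y (Suc (Suc n)) - ?y (Suc n)"
    unfolding sqrt_majorant.simps(2)[of "Suc n"] by (simp add: field_simps)
  finally show ?case .
qed

lemma Cauchy_sqrt_iter:
  assumes "norm X \<le> 1" shows "Cauchy (sqrt_iter X)"
proof -
  have mono: "incseq sqrt_majorant" using sqrt_majorant_mono by (rule incseq_SucI)
  have step: "norm (sqrt_iter X (m + k) - sqrt_iter X m) \<le> sqrt_majorant (m + k) - sqrt_majorant m" for m k
  proof (induction k)
    case (Suc k)
    have "norm (sqrt_iter X (m + Suc k) - sqrt_iter X m) \<le>
        norm (sqrt_iter X (Suc (m + k)) - sqrt_iter X (m + k)) + norm (sqrt_iter X (m + k) - sqrt_iter X m)"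
      using norm_triangle_ineq[of "sqrt_iter X (Suc (m + k)) - sqrt_iter X (m + k)"
        "sqrt_iter X (m + k) - sqrt_iter X m"] by (simp del: sqrt_iter.simps)
    also have "\<dots> \<le> (sqrt_majorant (Suc (m + k)) - sqrt_majorant (m + k)) +
        (sqrt_majorant (m + k) - sqrt_majorant m)"
      by (intro add_mono Suc norm_sqrt_iter_diff_le assms)
    finally show ?case by simp
  qed simp
  obtain L where "sqrt_majorant \<longlonglongrightarrow> L"
    using incseq_convergent[OF mono, of 1] sqrt_majorant_bounds by metis
  then have "Cauchy sqrt_majorant" using LIMSEQ_imp_Cauchy by blast
  show ?thesis
  proof (rule CauchyI')
    fix e :: real assume "0 < e"
    then obtain M where M: "\<And>m n. M \<le> m \<Longrightarrow> M \<le> n \<Longrightarrow> norm (sqrt_majorant m - sqrt_majorant n) < e"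
      using CauchyD[OF \<open>Cauchy sqrt_majorant\<close>] by metis
    have "norm (sqrt_iter X m - sqrt_iter X n) < e" if "M \<le> m" "m < n" for m n
    proof -
      have "norm (sqrt_iter X n - sqrt_iter X m) \<le> sqrt_majorant n - sqrt_majorant m"
        using step[of m "n - m"] that by simp
      also have "\<dots> < e" using M[of n m] that by simp
      finally show ?thesis by (simp add: norm_minus_commute)
    qed
    then show "\<exists>M. \<forall>m\<ge>M. \<forall>n>m. dist (sqrt_iter X m) (sqrt_iter X n) < e"
      unfolding dist_norm by blast
  qed
qed

text \<open>Every iterate is a polynomial in \<open>X\<close> with real coefficients; this is why
  symmetry of \<open>X\<close>, and below commutation with \<open>X\<close>, pass to it.\<close>

lemma sqrt_iter_symmetric:
  fixes X :: "'a::real_inner \<Rightarrow>\<^sub>L 'a"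
  assumes "\<And>x y. X x \<bullet> y = x \<bullet> X y"
  shows "sqrt_iter X n x \<bullet> y = x \<bullet> sqrt_iter X n y"
proof (induction n arbitrary: x y)
  case (Suc n)
  then show ?case
    by (simp add: blinfun.add_left blinfun.scaleR_left assms inner_add_left inner_add_right)
qed simp

lemma sqrt_iter_commute:
  fixes X :: "'a::real_normed_vector \<Rightarrow>\<^sub>L 'a"
  assumes U: "bounded_linear U" and "\<And>x. U (X x) = X (U x)"
  shows "U (sqrt_iter X n x) = sqrt_iter X n (U x)"
proof (induction n arbitrary: x)
  case 0
  show ?case using linear_simps[OF U] by simp
next
  case (Suc n)
  then show ?case
    by (simp add: blinfun.add_left blinfun.scaleR_left assms linear_simps[OF U])
qed

lemma positive_op_sqrt_exists:
  fixes T :: "'a::{real_inner,banach} \<Rightarrow> 'a"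
  assumes T: "positive_op T"
  obtains S where "positive_op S" "S \<circ> S = T"
    "\<And>U. bounded_linear U \<Longrightarrow> U \<circ> T = T \<circ> U \<Longrightarrow> U \<circ> S = S \<circ> U"
proof -
  have lin: "bounded_linear T" and sym: "\<And>x y. T x \<bullet> y = x \<bullet> T y" and pos: "\<And>x. 0 \<le> T x \<bullet> x"
    using T by (auto simp: positive_op_def symmetric_op_def)
  obtain K where K: "0 < K" "\<And>x. norm (T x) \<le> norm x * K"
    using bounded_linear.pos_bounded[OF lin] by metis
  \<comment> \<open>Dividing by the bound \<open>K\<close> brings \<open>T\<close> below the
    identity, so that \<open>X\<close> has norm at most \<open>1\<close>.\<close>
  define X where "X = Blinfun (\<lambda>x. x - (1/K) *\<^sub>R T x)"
  have X: "blinfun_apply X x = x - (1/K) *\<^sub>R T x" for x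
    unfolding X_def using lin
    by (subst bounded_linear_Blinfun_apply)
      (auto intro!: bounded_linear_sub bounded_linear_ident bounded_linear_scaleR_right[THEN bounded_linear_compose])
  have "norm (X x) \<le> norm x" for x
  proof -
    have "(norm (T x))\<^sup>2 \<le> K * (T x \<bullet> x)"
      using positive_op_norm_le[OF T] K(2) by (simp add: mult.commute)
    then have "(norm (T x))\<^sup>2 / K\<^sup>2 \<le> (T x \<bullet> x) / K"
      using K(1) by (simp add: field_simps power2_eq_square)
    moreover have "0 \<le> (T x \<bullet> x) / K" using K(1) pos by simp
    moreover have "(norm (X x))\<^sup>2 = (norm x)\<^sup>2 - 2 * ((T x \<bullet> x) / K) + (norm (T x))\<^sup>2 / K\<^sup>2"
      by (simp only: X power2_norm_eq_inner)
        (simp add: inner_simps inner_commute power2_eq_square)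
    ultimately have "(norm (X x))\<^sup>2 \<le> (norm x)\<^sup>2" by linarith
    then show ?thesis by (rule power2_le_imp_le) simp
  qed
  then have nX: "norm X \<le> 1" by (intro norm_blinfun_bound) auto
  obtain Y where Y: "sqrt_iter X \<longlonglongrightarrow> Y"
    using Cauchy_sqrt_iter[OF nX] Cauchy_convergent convergent_def by blast
  have Yx: "(\<lambda>n. sqrt_iter X n x) \<longlonglongrightarrow> Y x" for x
    by (rule blinfun.tendsto[OF Y tendsto_const])
  have "(\<lambda>n. sqrt_iter X (Suc n)) \<longlonglongrightarrow> (1/2) *\<^sub>R (X + (Y o\<^sub>L Y))"
    unfolding sqrt_iter.simps
    by (intro tendsto_intros bounded_bilinear.tendsto[OF bounded_bilinear_blinfun_compose] Y)
  then have Yeq: "Y = (1/2) *\<^sub>R (X + (Y o\<^sub>L Y))"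
    using LIMSEQ_Suc[OF Y] LIMSEQ_unique by blast
  have YY: "Y (Y x) = 2 *\<^sub>R Y x - X x" for x
    by (subst (3) Yeq) (simp add: blinfun.add_left blinfun.scaleR_left)
  have "norm (sqrt_iter X n) \<le> 1" for n
    using norm_sqrt_iter_le[OF nX, of n] sqrt_majorant_bounds[of n] by simp
  then have nY: "norm Y \<le> 1"
    using tendsto_norm[OF Y] by (meson LIMSEQ_le_const2)
  have Xsym: "X x \<bullet> y = x \<bullet> X y" for x y
    by (simp add: X inner_simps sym)
  have Ysym: "Y x \<bullet> y = x \<bullet> Y y" for x y
  proof -
    have "(\<lambda>n. sqrt_iter X n x \<bullet> y) \<longlonglongrightarrow> Y x \<bullet> y" "(\<lambda>n. x \<bullet> sqrt_iter X n y) \<longlonglongrightarrow> x \<bullet> Y y"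
      by (intro tendsto_intros Yx)+
    then show ?thesis using sqrt_iter_symmetric[of X, OF Xsym] LIMSEQ_unique by simp
  qed
  \<comment> \<open>By \<open>YY\<close>, \<open>(1 - Y)^2 = 1 - 2 Y + Y^2 = 1 - X = T / K\<close>,
    which explains the factor \<open>sqrt K\<close>.\<close>
  define S where "S x = sqrt K *\<^sub>R (x - Y x)" for x
  have Slin: "bounded_linear S" unfolding S_def
    by (intro bounded_linear_const_scaleR bounded_linear_sub bounded_linear_ident blinfun.bounded_linear_right)
  show thesis
  proof
    have "Y x \<bullet> x \<le> x \<bullet> x" for x
    proof -
      have "Y x \<bullet> x \<le> norm (Y x) * norm x" by (rule norm_cauchy_schwarz)
      also have "\<dots> \<le> norm x * norm x"
        using norm_blinfun[of Y x] mult_right_mono[OF nY, of "norm x"]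
        by (intro mult_right_mono) auto
      finally show ?thesis by (simp flip: power2_eq_square add: power2_norm_eq_inner)
    qed
    then show "positive_op S"
      using Slin K(1) Ysym unfolding positive_op_def symmetric_op_def
      by (auto simp: S_def inner_simps)
    show "S \<circ> S = T"
    proof
      fix x
      have "S (S x) = K *\<^sub>R (x - 2 *\<^sub>R Y x + Y (Y x))"
        using K(1) unfolding S_def
        by (simp add: blinfun.scaleR_right blinfun.diff_right algebra_simps scaleR_2)
      also have "\<dots> = T x" using K(1) by (simp add: YY X)
      finally show "(S \<circ> S) x = T x" by simp
    qed
    fix U assume U: "bounded_linear U" "U \<circ> T = T \<circ> U"
    have "U (T x) = T (U x)" for x using U(2) by (metis comp_apply)
    then have UX: "U (X x) = X (U x)" for x
      by (simp add: X linear_simps[OF U(1)])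
    have "U (Y x) = Y (U x)" for x
    proof -
      have "(\<lambda>n. U (sqrt_iter X n x)) \<longlonglongrightarrow> U (Y x)" by (rule bounded_linear.tendsto[OF U(1) Yx])
      then show ?thesis using Yx[of "U x"] sqrt_iter_commute[OF U(1) UX] LIMSEQ_unique by simp
    qed
    then show "U \<circ> S = S \<circ> U"
      by (auto simp: S_def linear_simps[OF U(1)])
  qed
qed

text \<open>Put \<open>y = S x - R x\<close>. Commutativity gives \<open>(S + R) y = 0\<close>, so
  both nonnegative forms vanish at \<open>y\<close>. Hence \<open>S y = R y = 0\<close>, and
  \<open>(y, y) = (x, (S - R) y) = 0\<close>.\<close>

lemma positive_op_sqrt_unique:
  assumes S: "positive_op S" and R: "positive_op R" and eq: "S \<circ> S = R \<circ> R" and com: "S \<circ> R = R \<circ> S"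
  shows "S = R"
proof
  fix x
  have lin: "bounded_linear S" "bounded_linear R"
    and sym: "\<And>x y. S x \<bullet> y = x \<bullet> S y" "\<And>x y. R x \<bullet> y = x \<bullet> R y"
    and pos: "\<And>x. 0 \<le> S x \<bullet> x" "\<And>x. 0 \<le> R x \<bullet> x"
    using S R by (auto simp: positive_op_def symmetric_op_def)
  have eq': "S (S x) = R (R x)" "S (R x) = R (S x)" for x
    using eq com by (metis comp_apply)+
  define y where "y = S x - R x"
  have "S y + R y = 0"
    by (simp add: y_def linear_simps[OF lin(1)] linear_simps[OF lin(2)] eq')
  then have "S y \<bullet> y + R y \<bullet> y = 0" by (simp flip: inner_add_left)
  with pos[of y] have "S y = 0" "R y = 0"
    using positive_op_eq_0[OF S] positive_op_eq_0[OF R] by (auto simp: add_nonneg_eq_0_iff)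
  then have "y \<bullet> y = 0" by (simp add: y_def inner_diff_left sym)
  then show "S x = R x" by (simp add: y_def)
qed

section \<open>Nonnegative operators on a complex space and their roots\<close>

text \<open>Polarisation: reality of the form at \<open>x + y\<close> and at
  \<open>x + \<i> y\<close> settles the imaginary and the real part. This is special to complex
  scalars.\<close>

lemma nonneg_on_symmetric:
  assumes T: "T \<in> bounded_ops UNIV UNIV" "nonneg_on UNIV T"
  shows "cinner (T x) y = cinner x (T y)"
proof -
  have im: "Im (cinner (T x) x) = 0" for x
    using T(2) by (simp add: nonneg_on_def complex_nonneg_Reals_iff complex_is_Real_iff)
  have 1: "Im (cinner (T x) y + cinner (T y) x) = 0" for x y
    using im[of "x + y"] im[of x] im[of y]
    by (simp add: bounded_opsD(2)[OF T(1)] cinner_add_left cinner_add_right)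
  have "Re (cinner (T x) y) = Re (cinner (T y) x)"
    using 1[of x "\<i> *\<^sub>C y"]
    by (simp add: bounded_opsD(3)[OF T(1)] cinner_scaleC_left cinner_scaleC_right)
  then have "cinner (T x) y = cnj (cinner (T y) x)"
    using 1[of x y] by (simp add: complex_eq_iff)
  then show ?thesis by (simp flip: cinner_commute)
qed

lemma nonneg_on_UNIV_iff:
  assumes "T \<in> bounded_ops UNIV UNIV"
  shows "nonneg_on UNIV T \<longleftrightarrow> positive_op T"
proof
  assume T: "nonneg_on UNIV T"
  show "positive_op T"
    using T nonneg_on_symmetric[OF assms T] assms
    by (auto simp: positive_op_def symmetric_op_def inner_eq_Re_cinner bounded_ops_UNIV nonneg_on_def
        complex_nonneg_Reals_iff)
next
  assume T: "positive_op T"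
  have "cinner (T x) x = cinner x (T x)" for x
    by (rule cinner_eqI)
      (metis T assms bounded_opsD(3) UNIV_I positive_op_def symmetric_op_def)
  then have "Im (cinner (T x) x) = 0" for x
    using cinner_commute[of "T x" x] by (simp add: complex_eq_iff)
  then show "nonneg_on UNIV T"
    using T by (simp add: nonneg_on_def complex_nonneg_Reals_iff positive_op_def inner_eq_Re_cinner)
qed

lemma op_sqrt_unique:
  assumes T: "T \<in> bounded_ops UNIV UNIV" "nonneg_on UNIV T"
  shows "\<exists>!S. S \<in> bounded_ops UNIV UNIV \<and> nonneg_on UNIV S \<and> S \<circ> S = T"
    and op_sqrt_commute: "\<And>U. bounded_linear U \<Longrightarrow> U \<circ> T = T \<circ> U \<Longrightarrow> U \<circ> op_sqrt T = op_sqrt T \<circ> U"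
proof -
  have "positive_op T" using T nonneg_on_UNIV_iff by blast
  then obtain S where S: "positive_op S" "S \<circ> S = T"
    and com: "\<And>U. bounded_linear U \<Longrightarrow> U \<circ> T = T \<circ> U \<Longrightarrow> U \<circ> S = S \<circ> U"
    using positive_op_sqrt_exists by metis
  have "(*\<^sub>C) c \<circ> S = S \<circ> (*\<^sub>C) c" for c
    by (rule com[OF bounded_linear_scaleC]) (auto simp: bounded_opsD[OF T(1)])
  then have "S (c *\<^sub>C x) = c *\<^sub>C S x" for c x
    by (metis comp_apply)
  with S(1) have Sb: "S \<in> bounded_ops UNIV UNIV"
    by (simp add: bounded_ops_UNIV positive_op_def symmetric_op_def)
  show ex1: "\<exists>!S. S \<in> bounded_ops UNIV UNIV \<and> nonneg_on UNIV S \<and> S \<circ> S = T"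
  proof (rule ex1I[of _ S])
    show "S \<in> bounded_ops UNIV UNIV \<and> nonneg_on UNIV S \<and> S \<circ> S = T"
      using S Sb nonneg_on_UNIV_iff by blast
    fix R assume R: "R \<in> bounded_ops UNIV UNIV \<and> nonneg_on UNIV R \<and> R \<circ> R = T"
    then have "positive_op R" using nonneg_on_UNIV_iff by blast
    \<comment> \<open>\<open>R\<close> commutes with its own square \<open>T\<close>, hence with
      \<open>S\<close>, as the uniqueness lemma requires.\<close>
    moreover have "R \<circ> S = S \<circ> R"
      using R com[of R] by (auto simp: bounded_ops_UNIV comp_assoc)
    ultimately show "R = S"
      using positive_op_sqrt_unique S R by metis
  qed
  have "op_sqrt T = S"
    unfolding op_sqrt_def by (rule the1_equality[OF ex1]) (use S Sb nonneg_on_UNIV_iff in blast)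
  then show "\<And>U. bounded_linear U \<Longrightarrow> U \<circ> T = T \<circ> U \<Longrightarrow> U \<circ> op_sqrt T = op_sqrt T \<circ> U"
    using com by simp
qed

lemma op_sqrt:
  assumes "T \<in> bounded_ops UNIV UNIV" "nonneg_on UNIV T"
  shows "op_sqrt T \<in> bounded_ops UNIV UNIV" "nonneg_on UNIV (op_sqrt T)" "op_sqrt T \<circ> op_sqrt T = T"
  using theI'[OF op_sqrt_unique(1)[OF assms]] unfolding op_sqrt_def by auto

section \<open>Finite-dimensional subspaces\<close>

lemma csubspace_span:
  fixes T :: "'a::complex_inner set"
  assumes "\<And>x. x \<in> T \<Longrightarrow> \<i> *\<^sub>C x \<in> span T"
  shows "complex_vector.subspace (span T)"
proof -
  have i: "\<i> *\<^sub>C x \<in> span T" if "x \<in> span T" for x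
    using that
  proof (induction rule: span_induct_alt)
    case (step c y z)
    have "\<i> *\<^sub>C (c *\<^sub>R y + z) = c *\<^sub>R (\<i> *\<^sub>C y) + \<i> *\<^sub>C z"
      by (simp add: scaleC_add_right scaleC_scaleC mult.commute flip: scaleC_of_real)
    with step assms show ?case by (simp add: span_add span_scale)
  qed (simp add: span_0)
  have "c *\<^sub>C x \<in> span T" if "x \<in> span T" for c x
  proof -
    have "c *\<^sub>C x = (of_real (Re c) + \<i> * of_real (Im c)) *\<^sub>C x"
      by (simp flip: complex_eq)
    also have "\<dots> = Re c *\<^sub>R x + Im c *\<^sub>R (\<i> *\<^sub>C x)"
      by (simp add: scaleC_add_left scaleC_scaleC mult.commute flip: scaleC_of_real)
    finally show ?thesis using i that by (simp add: span_add span_scale)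
  qed
  then show ?thesis
    by (simp add: complex_vector.subspace_def span_0 span_add)
qed

text \<open>Adjoining the multiples by \<open>\<i>\<close> turns complex generators into real ones.
  It carries the finite complex dimension of \<open>range P\<close> over to the real linear algebra
  of the estimate below.\<close>

lemma cspan_finite_subset_span:
  fixes S :: "'a::complex_inner set"
  assumes "finite S"
  obtains T where "finite T" "complex_vector.span S \<subseteq> span T"
proof
  let ?T = "S \<union> (*\<^sub>C) \<i> ` S"
  show "finite ?T" using assms by simp
  have "complex_vector.subspace (span ?T)"
  proof (rule csubspace_span)
    fix x assume "x \<in> ?T"
    then show "\<i> *\<^sub>C x \<in> span ?T"
    proof
      assume "x \<in> S" then show ?thesis by (intro span_base) auto
    next
      assume "x \<in> (*\<^sub>C) \<i> ` S"
      then obtain y where "y \<in> S" "x = \<i> *\<^sub>C y" by blast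
      then have "\<i> *\<^sub>C x = - y" by (simp add: scaleC_scaleC flip: scaleC_of_real)
      with \<open>y \<in> S\<close> show ?thesis by (simp add: span_neg span_base)
    qed
  qed
  then show "complex_vector.span S \<subseteq> span ?T"
    by (rule complex_vector.span_minimal[rotated]) (auto intro: span_base)
qed

lemma orthogonal_expansion:
  fixes W :: "'a::real_inner set"
  assumes "finite W" "pairwise orthogonal W" "x \<in> span W"
  shows "x = (\<Sum>w\<in>W. (x \<bullet> w / (w \<bullet> w)) *\<^sub>R w)"
proof -
  define d where "d = x - (\<Sum>w\<in>W. (x \<bullet> w / (w \<bullet> w)) *\<^sub>R w)"
  have "orthogonal d w" if "w \<in> W" for w
  proof -
    \<comment> \<open>Zero vectors in \<open>W\<close> are harmless: for \<open>w = 0\<close> both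
      sides are \<open>0\<close>.\<close>
    have "(\<Sum>v\<in>W. (x \<bullet> v / (v \<bullet> v)) *\<^sub>R v) \<bullet> w = (\<Sum>v\<in>W. if v = w then x \<bullet> w else 0)"
      unfolding inner_sum_left using assms(2) that
      by (intro sum.cong) (auto simp: pairwise_def orthogonal_def)
    also have "\<dots> = x \<bullet> w" using that assms(1) by simp
    finally show ?thesis by (simp add: d_def orthogonal_def inner_diff_left)
  qed
  moreover have "d \<in> span W"
    unfolding d_def by (rule span_diff[OF assms(3) span_sum]) (simp add: span_scale span_base)
  ultimately have "orthogonal d d" by (meson orthogonal_to_span)
  then show ?thesis by (simp add: orthogonal_def d_def)
qed

text \<open>In substance, the linear map \<open>g f^-1\<close> on the finite-dimensional inner
  product space \<open>f L\<close> is bounded, and an orthogonal spanning set makes the constant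
  explicit. It will be applied with \<open>f = R\<close> and \<open>g = B\<close> on
  \<open>range P\<close>.\<close>

lemma finite_dimensional_dominated:
  fixes f :: "'a::real_vector \<Rightarrow> 'b::real_inner" and g :: "'a \<Rightarrow> 'c::real_normed_vector"
  assumes lin: "linear f" "linear g"
    and L: "subspace L" "L \<subseteq> span S" "finite S"
    and inj: "\<And>x. x \<in> L \<Longrightarrow> f x = 0 \<Longrightarrow> x = 0"
  obtains K where "0 \<le> K" "\<And>x. x \<in> L \<Longrightarrow> norm (g x) \<le> K * norm (f x)"
proof -
  obtain B where B: "B \<subseteq> f ` L" "independent B" "f ` L \<subseteq> span B"
    using maximal_independent_subset by blast
  have "B \<subseteq> span (f ` S)"
    using B(1) L(2) by (metis image_mono linear_span_image[OF lin(1)] order_trans)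
  then have "finite B"
    using independent_span_bound[OF _ B(2), of "f ` S"] L(3) by simp
  then obtain W where W: "finite W" "span W = span B" "pairwise orthogonal W"
    using basis_orthogonal by metis
  have spW: "span W = f ` L"
    using W(2) span_subspace[OF B(1,3)] linear_subspace_image[OF lin(1) L(1)] by simp
  have "\<exists>l\<in>L. f l = w" if "w \<in> W" for w
    using span_base[OF that] spW by auto
  then obtain l where l: "\<And>w. w \<in> W \<Longrightarrow> l w \<in> L" "\<And>w. w \<in> W \<Longrightarrow> f (l w) = w"
    by metis
  show thesis
  proof
    show "0 \<le> (\<Sum>w\<in>W. norm (g (l w)) / norm w)" by (intro sum_nonneg) simp
    fix x assume x: "x \<in> L"
    \<comment> \<open>A preimage of \<open>f x\<close> assembled from the chosen preimages;
      injectivity identifies it with \<open>x\<close>.\<close>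
    define y where "y = (\<Sum>w\<in>W. (f x \<bullet> w / (w \<bullet> w)) *\<^sub>R l w)"
    have "f y = (\<Sum>w\<in>W. (f x \<bullet> w / (w \<bullet> w)) *\<^sub>R w)"
      unfolding y_def by (simp add: linear_sum[OF lin(1)] linear_scale[OF lin(1)] l)
    also have "\<dots> = f x" using orthogonal_expansion[OF W(1,3), of "f x"] spW x by auto
    finally have "f (x - y) = 0" by (simp add: linear_diff[OF lin(1)])
    moreover have "y \<in> L" unfolding y_def using l(1) L(1) by (intro subspace_sum subspace_scale)
    ultimately have "x = y" using inj[of "x - y"] x L(1) by (simp add: subspace_diff)
    have "g y = (\<Sum>w\<in>W. (f x \<bullet> w / (w \<bullet> w)) *\<^sub>R g (l w))"
      by (simp add: y_def linear_sum[OF lin(2)] linear_scale[OF lin(2)])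
    with \<open>x = y\<close> have "norm (g x) = norm (\<Sum>w\<in>W. (f x \<bullet> w / (w \<bullet> w)) *\<^sub>R g (l w))"
      by simp
    also have "\<dots> \<le> (\<Sum>w\<in>W. norm (f x) * (norm (g (l w)) / norm w))"
    proof (rule sum_norm_le)
      fix w
      have "\<bar>f x \<bullet> w\<bar> / (norm w * norm w) * norm (g (l w)) \<le>
          (norm (f x) * norm w) / (norm w * norm w) * norm (g (l w))"
        by (intro mult_right_mono divide_right_mono Cauchy_Schwarz_ineq2) auto
      then show "norm ((f x \<bullet> w / (w \<bullet> w)) *\<^sub>R g (l w)) \<le> norm (f x) * (norm (g (l w)) / norm w)"
        by (cases "w = 0") (simp_all add: abs_divide power2_eq_square flip: power2_norm_eq_inner)
    qed
    finally show "norm (g x) \<le> (\<Sum>w\<in>W. norm (g (l w)) / norm w) * norm (f x)"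
      by (simp add: sum_distrib_left mult.commute)
  qed
qed

lemma cdimension_finiteD:
  assumes "cdimension V < \<infinity>"
  obtains S where "finite S" "V \<subseteq> complex_vector.span S" "cdimension V = enat (complex_vector.dim V)"
proof -
  obtain S where "finite S" "V \<subseteq> complex_vector.span S"
    using assms unfolding cdimension_def by (auto split: if_splits)
  moreover from this have "cdimension V = enat (complex_vector.dim V)"
    unfolding cdimension_def by auto
  ultimately show thesis by (rule that)
qed

text \<open>The image of a basis of \<open>V\<close> is independent and extends to a basis of
  \<open>W\<close>. Both have the same finite cardinality, so the extension adds nothing. Finiteness
  is also what makes equal values of \<open>cdimension\<close> mean equal dimensions.\<close>

lemma injective_image_eq_of_cdimension_eq:
  fixes f :: "'a::complex_inner \<Rightarrow> 'b::complex_inner"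
  assumes f: "Vector_Spaces.linear scaleC scaleC f"
    and V: "complex_vector.subspace V" and W: "complex_vector.subspace W"
    and dim: "cdimension V = cdimension W" "cdimension W < \<infinity>"
    and fV: "f ` V \<subseteq> W" and inj: "\<And>x. x \<in> V \<Longrightarrow> f x = 0 \<Longrightarrow> x = 0"
  shows "f ` V = W"
proof -
  obtain S where S: "finite S" "W \<subseteq> complex_vector.span S"
    and dW: "cdimension W = enat (complex_vector.dim W)"
    using cdimension_finiteD[OF dim(2)] .
  have "complex_vector.dim V = complex_vector.dim W"
    using cdimension_finiteD[of V] dim dW by (metis enat.inject)
  moreover obtain B where B: "B \<subseteq> V" "complex_vector.independent B" "V \<subseteq> complex_vector.span B"
    "card B = complex_vector.dim V"
    using complex_vector.basis_exists by blast
  have spB: "complex_vector.span B = V"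
    using B V complex_vector.span_subspace by blast
  have injV: "inj_on f V"
  proof (rule inj_onI)
    fix x y assume "x \<in> V" "y \<in> V" "f x = f y"
    then show "x = y"
      using inj[of "x - y"] V complex_vector.linear_diff[OF f] complex_vector.subspace_diff by fastforce
  qed
  have ind: "complex_vector.independent (f ` B)"
    by (rule complex_vector.linear_independent_injective_image[OF f B(2)]) (simp add: spB injV)
  obtain B' where B': "f ` B \<subseteq> B'" "B' \<subseteq> W" "complex_vector.independent B'" "W \<subseteq> complex_vector.span B'"
    using complex_vector.maximal_independent_subset_extend[of "f ` B" W] ind B(1) fV by blast
  have "finite B'"
    using complex_vector.independent_span_bound[OF S(1) B'(3)] B'(2) S(2) by blast
  moreover have "card B' = complex_vector.dim W"
    using complex_vector.basis_card_eq_dim B' by blast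
  moreover have "card (f ` B) = card B"
    using injV B(1) by (meson card_image inj_on_subset)
  ultimately have "f ` B = B'"
    using B(4) B'(1) by (metis card_subset_eq)
  then have "W \<subseteq> f ` V"
    using B'(4) complex_vector.linear_span_image[OF f, of B] spB by simp
  with fV show ?thesis by blast
qed

section \<open>The negative spectral subspace\<close>

lemma spectral_measure_additive:
  assumes "spectral_measure A E" "S \<in> sets borel" "T \<in> sets borel" "S \<inter> T = {}"
  shows "E (S \<union> T) x = E S x + E T x"
proof -
  have sums: "(\<lambda>n. E (F n) x) sums E (\<Union>n. F n) x"
    if "range F \<subseteq> sets borel" "disjoint_family F" for F :: "nat \<Rightarrow> real set"
    using assms(1) that unfolding spectral_measure_def by blast
  \<comment> \<open>A convergent series with constant terms has terms \<open>0\<close>.\<close>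
  have "(\<lambda>n::nat. E {} x) sums E {} x"
    using sums[of "\<lambda>_. {}"] by (simp add: disjoint_family_on_def)
  then have empty: "E {} x = 0"
    using sums_summable summable_LIMSEQ_zero tendsto_const LIMSEQ_unique by metis
  have "(\<lambda>n. E (binaryset S T n) x) sums (E S x + E T x)"
    using sums_If_finite_set[of "{0, 1::nat}" "\<lambda>n. E (binaryset S T n) x"] empty
    by (auto simp: binaryset_def cong: if_cong elim!: sums_cong[THEN iffD1, rotated])
  moreover have "(\<lambda>n. E (binaryset S T n) x) sums E (\<Union>n. binaryset S T n) x"
    using assms by (intro sums) (auto simp: disjoint_family_on_def binaryset_def)
  ultimately show ?thesis
    using sums_unique2 by (fastforce simp: UN_binaryset_eq)
qed

lemma spectral_measure_projection:
  assumes "spectral_measure A E" "S \<in> sets borel"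
  shows "selfadjoint (E S)" "E S (E S x) = E S x"
  using assms unfolding spectral_measure_def by (auto simp: fun_eq_iff)

lemma projection_inner:
  assumes "selfadjoint P" "\<And>x. P (P x) = P x"
  shows "cinner (P x) y = cinner (P x) (P y)" "P x \<bullet> x = (norm (P x))\<^sup>2"
proof -
  show *: "cinner (P x) y = cinner (P x) (P y)" for x y
    using assms by (metis selfadjoint_iff)
  then show "P x \<bullet> x = (norm (P x))\<^sup>2"
    by (metis inner_eq_Re_cinner power2_norm_eq_inner)
qed

text \<open>By additivity \<open>E (S \<union> T)\<close> would lengthen \<open>x\<close> if
  \<open>E S x\<close> were nonzero, but a selfadjoint idempotent is a contraction.\<close>

lemma spectral_measure_disjoint:
  assumes E: "spectral_measure A E" and ST: "S \<in> sets borel" "T \<in> sets borel" "S \<inter> T = {}"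
    and x: "E T x = x"
  shows "E S x = 0"
proof -
  have ns: "E U x \<bullet> x = (norm (E U x))\<^sup>2" if "U \<in> sets borel" for U
    using projection_inner(2) spectral_measure_projection[OF E that] by blast
  have "(norm (E (S \<union> T) x))\<^sup>2 = (norm (E S x))\<^sup>2 + (norm x)\<^sup>2"
    using ns[of "S \<union> T"] ns[of S] ST
    by (simp add: spectral_measure_additive[OF E] x inner_add_left power2_norm_eq_inner)
  moreover have "(norm (E (S \<union> T) x))\<^sup>2 \<le> norm (E (S \<union> T) x) * norm x"
    using ns[of "S \<union> T"] ST norm_cauchy_schwarz[of "E (S \<union> T) x" x] by simp
  then have "norm (E (S \<union> T) x) \<le> norm x"
    by (cases "E (S \<union> T) x = 0") (auto simp: power2_eq_square)
  then have "(norm (E (S \<union> T) x))\<^sup>2 \<le> (norm x)\<^sup>2" by (simp add: power_mono)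
  ultimately show ?thesis by simp
qed

section \<open>Scalar measures and the sign of the quadratic form\<close>

lemma emeasure_scalar_measure:
  assumes E: "spectral_measure A E" and S: "S \<in> sets borel"
  shows "emeasure (scalar_measure E x) S = ennreal (Re (cinner (E S x) x))"
proof -
  have pos: "0 \<le> Re (cinner (E S x) x)" if "S \<in> sets borel" for S
    using projection_inner(2)[of "E S" x] spectral_measure_projection[OF E that]
    by (simp add: inner_eq_Re_cinner)
  show ?thesis unfolding scalar_measure_def
  proof (rule emeasure_measure_of_sigma)
    show "sigma_algebra UNIV (sets borel)"
      using sets.sigma_algebra_axioms[of borel] by simp
    have "E {} x = 0"
      using spectral_measure_additive[OF E, of "{}" "{}" x] by simp
    then show "positive (sets borel) (\<lambda>S. ennreal (Re (cinner (E S x) x)))"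
      by (simp add: positive_def)
    show "countably_additive (sets borel) (\<lambda>S. ennreal (Re (cinner (E S x) x)))"
    proof (rule countably_additiveI)
      fix F :: "nat \<Rightarrow> real set"
      assume F: "range F \<subseteq> sets borel" "disjoint_family F"
      then have "(\<lambda>n. E (F n) x) sums E (\<Union>n. F n) x"
        using E unfolding spectral_measure_def by blast
      then have "(\<lambda>n. Re (cinner (E (F n) x) x)) sums Re (cinner (E (\<Union>n. F n) x) x)"
        unfolding inner_eq_Re_cinner[symmetric]
        by (rule bounded_linear.sums[OF bounded_linear_inner_left])
      then show "(\<Sum>n. ennreal (Re (cinner (E (F n) x) x))) = ennreal (Re (cinner (E (\<Union>n. F n) x) x))"
        using F by (intro suminf_ennreal_eq pos) auto
    qed
    show "S \<in> sets borel" by (rule S)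
  qed
qed

lemma spectral_measure_integral:
  assumes "spectral_measure A E"
  shows "has_bochner_integral (scalar_measure E x) (\<lambda>t. t) (A x \<bullet> x)"
proof -
  have "has_bochner_integral (scalar_measure E x) complex_of_real (cinner (A x) x)"
    using assms unfolding spectral_measure_def by blast
  then show ?thesis
    using has_bochner_integral_bounded_linear[OF bounded_linear_Re] by (fastforce simp: inner_eq_Re_cinner)
qed

lemma AE_scalar_measure:
  assumes E: "spectral_measure A E" and S: "S \<in> sets borel" and x: "E S x = x"
  shows "AE t in scalar_measure E x. t \<in> S"
proof (rule AE_I[of _ _ "- S"])
  have S': "- S \<in> sets borel" using S by auto
  then show "- S \<in> sets (scalar_measure E x)"
    by (simp add: scalar_measure_def)
  have "E (- S) x = 0"
    by (rule spectral_measure_disjoint[OF E S' S _ x]) simp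
  then show "emeasure (scalar_measure E x) (- S) = 0"
    by (simp add: emeasure_scalar_measure[OF E S'])
qed auto

text \<open>The scalar measure of \<open>x\<close> has total mass \<open>(x, x)\<close> and is
  carried by the half-line that the projection selects, so the sign of the integrand decides. For
  strictness, a vanishing integral would make the measure null.\<close>

lemma spectral_measure_negative:
  assumes E: "spectral_measure A E"
  shows "E {..<0} x = x \<Longrightarrow> x \<noteq> 0 \<Longrightarrow> A x \<bullet> x < 0"
    and "E {..<0} x = 0 \<Longrightarrow> 0 \<le> A x \<bullet> x"
proof -
  note int = spectral_measure_integral[OF E, of x]
  have EU: "E UNIV = id" using E unfolding spectral_measure_def by blast
  show "A x \<bullet> x < 0" if x: "E {..<0} x = x" "x \<noteq> 0"
  proof (rule ccontr)
    assume nn: "\<not> A x \<bullet> x < 0"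
    have AE: "AE t in scalar_measure E x. t < 0"
      using AE_scalar_measure[OF E _ x(1)] by simp
    have int': "integrable (scalar_measure E x) (\<lambda>t. - t)"
      using int by (auto simp: has_bochner_integral_iff)
    have "(\<integral>t. - t \<partial>scalar_measure E x) = - (A x \<bullet> x)"
      using int by (simp add: has_bochner_integral_iff)
    moreover have "0 \<le> (\<integral>t. - t \<partial>scalar_measure E x)"
      by (rule integral_nonneg_AE) (use AE in auto)
    ultimately have "(\<integral>t. - t \<partial>scalar_measure E x) = 0" using nn by simp
    then have "AE t in scalar_measure E x. - t = 0"
      using integral_nonneg_eq_0_iff_AE[OF int'] eventually_mono[OF AE, of "\<lambda>t. 0 \<le> - t"] by simp
    with AE have "AE t in scalar_measure E x. False" by eventually_elim simp
    then have "emeasure (scalar_measure E x) (space (scalar_measure E x)) = 0"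
      by (metis AE_iff_null_sets null_setsD1 sets.top UNIV_I eventually_mono AE_E2 ae_filter_eq_bot_iff
          trivial_limit_def)
    then have "ennreal (x \<bullet> x) = 0"
      using emeasure_scalar_measure[OF E, of UNIV x] EU
      by (simp add: scalar_measure_def inner_eq_Re_cinner)
    then have "x \<bullet> x \<le> 0" by (simp add: ennreal_eq_0_iff)
    with x(2) show False by (metis inner_gt_zero_iff not_less)
  qed
  show "0 \<le> A x \<bullet> x" if x: "E {..<0} x = 0"
  proof -
    have "E ({..<0} \<union> {0..}) x = E {..<0} x + E {0..} x"
      by (rule spectral_measure_additive[OF E]) auto
    moreover have "{..<0} \<union> {0..} = (UNIV :: real set)" by auto
    ultimately have "E {0..} x = x" using x EU by simp
    then have "AE t in scalar_measure E x. 0 \<le> t"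
      using AE_scalar_measure[OF E, of "{0..}"] by simp
    then have "0 \<le> (\<integral>t. t \<partial>scalar_measure E x)"
      by (rule integral_nonneg_AE)
    then show ?thesis using int by (simp add: has_bochner_integral_iff)
  qed
qed

text \<open>
  If \<open>P u = u\<close> and \<open>P v = 0\<close> then \<open>u + v\<close> and \<open>u - v\<close> have the same scalar measure,
  hence the same value of the quadratic form of \<open>A\<close>.
\<close>

lemma spectral_measure_commute:
  assumes E: "spectral_measure A E" and A: "selfadjoint A"
  shows "A (E {..<0} x) = E {..<0} (A x)"
proof -
  let ?P = "E {..<0}"
  have P: "selfadjoint ?P" "\<And>x. ?P (?P x) = ?P x"
    using spectral_measure_projection[OF E, of "{..<0}"] by auto
  have Ab: "A \<in> bounded_ops UNIV UNIV" and Pb: "?P \<in> bounded_ops UNIV UNIV"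
    and Asym: "\<And>x y. cinner (A x) y = cinner x (A y)"
    and Psym: "\<And>x y. cinner (?P x) y = cinner x (?P y)"
    using A P(1) by (auto simp: selfadjoint_iff)
  note Ald = bounded_ops_linear(2-)[OF Ab]
  note Pld = bounded_ops_linear(2-)[OF Pb]
  have cross: "A u \<bullet> v = 0" if u: "?P u = u" and v: "?P v = 0" for u v
  proof -
    \<comment> \<open>\<open>E S u\<close> equals \<open>E (S \<inter> {..<0}) u\<close>, and
      \<open>E (S \<inter> {..<0})\<close> annihilates \<open>v\<close>. So the cross terms in the
      scalar measures of \<open>u + v\<close> and \<open>u - v\<close> vanish.\<close>
    have ES: "cinner (E S u) v = 0" if S: "S \<in> sets borel" for S
    proof -
      have "E S u = E (S \<inter> {..<0}) u + E (S \<inter> {0..}) u"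
      proof (subst spectral_measure_additive[OF E, symmetric])
        have "S = S \<inter> {..<0} \<union> S \<inter> {0..}" by auto
        then show "E S u = E (S \<inter> {..<0} \<union> S \<inter> {0..}) u" by simp
      qed (use S in auto)
      moreover have "E (S \<inter> {0..}) u = 0"
        by (rule spectral_measure_disjoint[OF E _ _ _ u]) (use S in auto)
      moreover have "E {0..} v = v"
      proof -
        have "E ({..<0} \<union> {0..}) v = E {..<0} v + E {0..} v"
          by (rule spectral_measure_additive[OF E]) auto
        moreover have "{..<0} \<union> {0..} = (UNIV :: real set)" by auto
        ultimately show ?thesis using v E unfolding spectral_measure_def by simp
      qed
      then have "E (S \<inter> {..<0}) v = 0"
        by (intro spectral_measure_disjoint[OF E, of _ "{0..}"]) (use S in auto)
      moreover have "cinner (E (S \<inter> {..<0}) u) v = cinner u (E (S \<inter> {..<0}) v)"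
        using spectral_measure_projection(1)[OF E, of "S \<inter> {..<0}"] S by (simp add: selfadjoint_iff)
      ultimately show ?thesis by (simp add: cinner.zero_right)
    qed
    have "scalar_measure E (u + v) = scalar_measure E (u - v)"
      unfolding scalar_measure_def
    proof (rule measure_of_eq)
      fix S assume "S \<in> sigma_sets UNIV (sets (borel :: real measure))"
      then have S: "S \<in> sets borel" by (metis sets.sigma_sets_eq space_borel)
      have sa: "selfadjoint (E S)" using spectral_measure_projection[OF E S] by simp
      then have b: "E S \<in> bounded_ops UNIV UNIV" by (simp add: selfadjoint_iff)
      note ld = bounded_ops_linear(2-)[OF b]
      have "cinner (E S v) u = 0"
        using ES[OF S] sa by (metis cinner_commute complex_cnj_zero selfadjoint_iff)
      then show "ennreal (Re (cinner (E S (u + v)) (u + v))) = ennreal (Re (cinner (E S (u - v)) (u - v)))"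
        using ES[OF S]
        by (simp add: ld cinner.add_left cinner.add_right cinner.diff_left cinner.diff_right)
    qed simp
    then have "A (u + v) \<bullet> (u + v) = A (u - v) \<bullet> (u - v)"
      using spectral_measure_integral[OF E, of "u + v"] spectral_measure_integral[OF E, of "u - v"]
      by (metis has_bochner_integral_eq)
    moreover have "A v \<bullet> u = A u \<bullet> v"
      using Asym[of v u] by (metis inner_commute inner_eq_Re_cinner)
    ultimately show ?thesis
      by (simp add: Ald inner_simps)
  qed
  have APker: "?P (A v) = 0" if v: "?P v = 0" for v
  proof -
    \<comment> \<open>With \<open>u = ?P (A v)\<close> the orthogonality yields the squared norm of
      \<open>?P (A v)\<close>, so \<open>A\<close> leaves the kernel of \<open>?P\<close>
      invariant.\<close>
    have "A (?P (A v)) \<bullet> v = 0" by (rule cross[OF P(2) v])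
    then have "(norm (?P (A v)))\<^sup>2 = 0"
      using projection_inner(2)[OF P, of "A v"] Asym[of "?P (A v)" v] by (simp add: inner_eq_Re_cinner)
    then show ?thesis by simp
  qed
  \<comment> \<open>The range of \<open>?P\<close> is invariant as well: this difference lies in the
    kernel of \<open>?P\<close> and is orthogonal to both of its terms.\<close>
  have "A (?P x) - ?P (A (?P x)) = 0"
  proof -
    let ?d = "A (?P x) - ?P (A (?P x))"
    have "?P ?d = 0" by (simp add: Pld P(2))
    then have "A (?P x) \<bullet> ?d = 0" by (rule cross[OF P(2)])
    moreover have "?P (A (?P x)) \<bullet> ?d = 0"
      using Psym \<open>?P ?d = 0\<close> by (metis cinner.zero_right inner_eq_Re_cinner zero_complex.sel(1))
    ultimately have "?d \<bullet> ?d = 0" by (simp add: inner_diff_left)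
    then show ?thesis by simp
  qed
  moreover have "?P (A (x - ?P x)) = 0"
    by (rule APker) (simp add: Pld P(2))
  ultimately show ?thesis by (simp add: Ald Pld)
qed

lemma bounded_ops_UNIV_I:
  assumes "bounded_linear T" "\<And>c x. T (c *\<^sub>C x) = c *\<^sub>C T x"
  shows "T \<in> bounded_ops UNIV UNIV"
  using assms bounded_ops_UNIV by blast

lemma bounded_ops_comp:
  assumes "S \<in> bounded_ops UNIV UNIV" "T \<in> bounded_ops UNIV UNIV"
  shows "S \<circ> T \<in> bounded_ops UNIV UNIV"
  using assms bounded_linear_compose by (auto simp: bounded_ops_UNIV comp_def)

lemma bounded_ops_csubspace_range:
  assumes "T \<in> bounded_ops UNIV UNIV"
  shows "complex_vector.subspace (range T)"
  unfolding complex_vector.subspace_def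
  by (metis (no_types, opaque_lifting) assms bounded_ops_linear(2,5,7) rangeE rangeI)

section \<open>Operators on dense subspaces\<close>

lemma csubspace_closure:
  fixes M :: "'a::complex_inner set"
  assumes "complex_vector.subspace M" shows "complex_vector.subspace (closure M)"
  unfolding complex_vector.subspace_def
proof (intro conjI ballI allI)
  show "0 \<in> closure M" using assms closure_subset complex_vector.subspace_0 by blast
  fix x y c assume x: "x \<in> closure M"
  then obtain f where f: "\<And>n. f n \<in> M" "f \<longlonglongrightarrow> x" unfolding closure_sequential by blast
  have "(\<lambda>n. c *\<^sub>C f n) \<longlonglongrightarrow> c *\<^sub>C x"
    using f(2) by (rule bounded_linear.tendsto[OF bounded_linear_scaleC])
  then show "c *\<^sub>C x \<in> closure M"
    using f(1) complex_vector.subspace_scale[OF assms] unfolding closure_sequential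
    by (intro exI[of _ "\<lambda>n. c *\<^sub>C f n"]) auto
  assume "y \<in> closure M"
  then obtain g where g: "\<And>n. g n \<in> M" "g \<longlonglongrightarrow> y" unfolding closure_sequential by blast
  show "x + y \<in> closure M"
    using f g tendsto_add[OF f(2) g(2)] complex_vector.subspace_add[OF assms] unfolding closure_sequential
    by (intro exI[of _ "\<lambda>n. f n + g n"]) auto
qed

lemma bounded_ops_eqI:
  assumes T: "T \<in> bounded_ops M N" "T' \<in> bounded_ops M N'" and M: "complex_vector.subspace M"
    and D: "D \<subseteq> M" "M \<subseteq> closure D" and eq: "\<And>x. x \<in> D \<Longrightarrow> T x = T' x"
  shows "T = T'"
proof
  fix x
  show "T x = T' x"
  proof (cases "x \<in> M")
    case True
    then obtain f where f: "\<And>n. f n \<in> D" "f \<longlonglongrightarrow> x"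
      using D(2) closure_sequential by blast
    have fM: "\<forall>n. f n \<in> M" using f(1) D(1) by blast
    have "(\<lambda>n. T (f n)) \<longlonglongrightarrow> T x" "(\<lambda>n. T' (f n)) \<longlonglongrightarrow> T' x"
      using bounded_ops_continuous_on[OF T(1) M] bounded_ops_continuous_on[OF T(2) M] fM f(2) True
      unfolding continuous_on_sequentially by (auto simp: comp_def)
    then show ?thesis using eq[OF f(1)] LIMSEQ_unique by simp
  qed (simp add: bounded_opsD(5)[OF T(1)] bounded_opsD(5)[OF T(2)])
qed

text \<open>The domination makes \<open>B x\<close> depend only on \<open>R x\<close>, by a
  Lipschitz map that extends to the closure of the range. Linearity passes to the limit along
  preimages.\<close>

lemma factor_through_dense_range:
  fixes R :: "'a::chilbert_space \<Rightarrow> 'a" and B :: "'a \<Rightarrow> 'b::chilbert_space"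
  assumes R: "R \<in> bounded_ops UNIV UNIV" and B: "B \<in> bounded_ops UNIV UNIV"
    and dom: "\<And>x. norm (B x) \<le> K * norm (R x)"
  obtains C where "C \<in> bounded_ops (cran R) UNIV" "B = C \<circ> R"
proof -
  have wd: "B x = B y" if "R x = R y" for x y
    using dom[of "x - y"] that by (simp add: bounded_ops_linear(3)[OF R] bounded_ops_linear(3)[OF B])
  define C0 where "C0 w = B (SOME x. R x = w)" for w
  have C0: "C0 (R x) = B x" for x
    unfolding C0_def by (rule wd) (rule someI[of _ x], rule refl)
  \<comment> \<open>A Lipschitz constant must be nonnegative, whereas the sign of \<open>K\<close>
    is unknown.\<close>
  have dom': "norm (B x) \<le> \<bar>K\<bar> * norm (R x)" for x
    by (rule order_trans[OF dom]) (simp add: mult_right_mono)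
  have "\<bar>K\<bar>-lipschitz_on (range R) C0"
  proof (rule lipschitz_onI)
    fix u v assume "u \<in> range R" "v \<in> range R"
    then obtain x y where "u = R x" "v = R y" by blast
    then show "dist (C0 u) (C0 v) \<le> \<bar>K\<bar> * dist u v"
      using dom'[of "x - y"]
      by (simp add: C0 dist_norm bounded_ops_linear(3)[OF R] bounded_ops_linear(3)[OF B])
  qed simp
  then obtain g where g: "\<bar>K\<bar>-lipschitz_on (cran R) g" "\<And>w. w \<in> range R \<Longrightarrow> g w = C0 w"
    using lipschitz_extend_closure by metis
  have gR: "g (R x) = B x" for x using g(2) C0 by simp
  have M: "complex_vector.subspace (cran R)"
    by (rule csubspace_closure[OF bounded_ops_csubspace_range[OF R]])
  have lim: "(\<lambda>n. B (r n)) \<longlonglongrightarrow> g x" if "(\<lambda>n. R (r n)) \<longlonglongrightarrow> x" for r x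
  proof -
    have "x \<in> cran R"
      unfolding closure_sequential by (rule exI[of _ "\<lambda>n. R (r n)"]) (simp add: that)
    moreover have "R (r n) \<in> cran R" for n using closure_subset[of "range R"] by auto
    ultimately show ?thesis
      using lipschitz_on_continuous_on[OF g(1), unfolded continuous_on_sequentially, rule_format,
        of x "\<lambda>n. R (r n)"] that
      by (simp add: comp_def gR)
  qed
  have approx: "\<exists>r. (\<lambda>n. R (r n)) \<longlonglongrightarrow> x" if x: "x \<in> cran R" for x
  proof -
    obtain f where f: "\<And>n. f n \<in> range R" "f \<longlonglongrightarrow> x"
      using x closure_sequential[of x "range R"] by auto
    then have "R (inv R (f n)) = f n" for n by (simp add: f_inv_into_f)
    with f(2) show ?thesis by (intro exI[of _ "\<lambda>n. inv R (f n)"]) simp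
  qed
  define C where "C = restrict g (cran R)"
  have "C \<in> bounded_ops (cran R) UNIV"
    unfolding bounded_ops_def
  proof (intro CollectI conjI ballI allI)
    show "C \<in> cran R \<rightarrow>\<^sub>E UNIV" by (simp add: C_def)
    show "\<exists>K. \<forall>x\<in>cran R. norm (C x) \<le> norm x * K"
    proof (intro exI ballI)
      fix x assume x: "x \<in> cran R"
      have "g 0 = 0" using gR[of 0] by (simp add: bounded_ops_linear(5)[OF R] bounded_ops_linear(5)[OF B])
      then show "norm (C x) \<le> norm x * \<bar>K\<bar>"
        using lipschitz_onD[OF g(1) x, of 0] x complex_vector.subspace_0[OF M]
        by (simp add: C_def dist_norm mult.commute)
    qed
    fix x assume x: "x \<in> cran R"
    obtain r where r: "(\<lambda>n. R (r n)) \<longlonglongrightarrow> x" using approx[OF x] by blast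
    {
      fix c
      have "(\<lambda>n. B (c *\<^sub>C r n)) \<longlonglongrightarrow> g (c *\<^sub>C x)"
        using bounded_linear.tendsto[OF bounded_linear_scaleC r]
        by (intro lim) (simp add: bounded_ops_linear(7)[OF R])
      moreover have "(\<lambda>n. B (c *\<^sub>C r n)) \<longlonglongrightarrow> c *\<^sub>C g x"
        using bounded_linear.tendsto[OF bounded_linear_scaleC lim[OF r]]
        by (simp add: bounded_ops_linear(7)[OF B])
      ultimately show "C (c *\<^sub>C x) = c *\<^sub>C C x"
        using x M LIMSEQ_unique by (simp add: C_def complex_vector.subspace_scale)
    }
    fix y assume y: "y \<in> cran R"
    obtain s where s: "(\<lambda>n. R (s n)) \<longlonglongrightarrow> y" using approx[OF y] by blast
    have "(\<lambda>n. B (r n + s n)) \<longlonglongrightarrow> g (x + y)"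
      using tendsto_add[OF r s] by (intro lim) (simp add: bounded_ops_linear(2)[OF R])
    moreover have "(\<lambda>n. B (r n + s n)) \<longlonglongrightarrow> g x + g y"
      using tendsto_add[OF lim[OF r] lim[OF s]] by (simp add: bounded_ops_linear(2)[OF B])
    ultimately show "C (x + y) = C x + C y"
      using x y M LIMSEQ_unique by (simp add: C_def complex_vector.subspace_add)
  qed
  moreover have "B = C \<circ> R"
    using closure_subset[of "range R"] gR by (auto simp: C_def fun_eq_iff)
  ultimately show thesis by (rule that)
qed

section \<open>The polar decomposition\<close>

text \<open>\<open>P\<close> is the spectral projection of \<open>A\<close> for \<open>(-\<infinity>, 0)\<close>.\<close>

locale negative_splitting =
  fixes A P :: "'a::chilbert_space \<Rightarrow> 'a"
  assumes A: "selfadjoint A" and P: "selfadjoint P" and PP: "P (P x) = P x"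
    and AP: "A (P x) = P (A x)"
    and negative: "P x = x \<Longrightarrow> x \<noteq> 0 \<Longrightarrow> A x \<bullet> x < 0"
    and nonnegative: "P x = 0 \<Longrightarrow> 0 \<le> A x \<bullet> x"

lemma negative_splitting_exists:
  assumes A: "selfadjoint A" and fin: "nu_minus A < \<infinity>"
  obtains P where "negative_splitting A P" "cdimension (range P) = nu_minus A"
proof -
  have "(\<lambda>E. cdimension (range (E {..<0}))) ` {E. spectral_measure A E} \<noteq> {}"
    using fin unfolding nu_minus_def by (intro notI) (simp add: top_enat_def)
  \<comment> \<open>A nonempty set of extended naturals attains its infimum.\<close>
  then have "nu_minus A \<in> (\<lambda>E. cdimension (range (E {..<0}))) ` {E. spectral_measure A E}"
    unfolding nu_minus_def Inf_enat_def by (auto intro: LeastI)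
  then obtain E where E: "spectral_measure A E" "nu_minus A = cdimension (range (E {..<0}))"
    by blast
  have "negative_splitting A (E {..<0})"
    using A spectral_measure_projection[OF E(1), of "{..<0}"] spectral_measure_commute[OF E(1) A]
      spectral_measure_negative[OF E(1)]
    by unfold_locales auto
  with E(2) that show thesis by simp
qed

context negative_splitting
begin

text \<open>The symmetry \<open>J_A\<close> extended to the whole space: it is the identity on the
  kernel of \<open>P\<close>, in particular on that of \<open>A\<close>. Its restriction to
  \<open>cran A\<close> will be \<open>op_sgn A\<close>.\<close>

abbreviation J :: "'a \<Rightarrow> 'a" where "J x \<equiv> x - 2 *\<^sub>R P x"
abbreviation R :: "'a \<Rightarrow> 'a" where "R \<equiv> op_sqrt (op_abs A)"

lemmas A_simps = bounded_ops_linear(2-)[OF selfadjointD(1)[OF A]]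
lemmas P_simps = bounded_ops_linear(2-)[OF selfadjointD(1)[OF P]]

lemma J_ops: "J \<in> bounded_ops UNIV UNIV"
proof (rule bounded_ops_UNIV_I)
  show "bounded_linear J"
    using bounded_ops_linear(1)[OF selfadjointD(1)[OF P]]
    by (intro bounded_linear_sub bounded_linear_ident bounded_linear_const_scaleR)
  show "J (c *\<^sub>C x) = c *\<^sub>C J x" for c x
    by (simp add: P_simps complex_vector.scale_right_diff_distrib mult.commute flip: scaleC_of_real)
qed

lemma J_J: "J (J x) = x"
  by (simp add: P_simps PP scaleR_2)

lemma J_selfadjoint: "selfadjoint J"
  using J_ops selfadjointD(2)[OF P]
  by (simp add: selfadjoint_iff cinner.diff_left cinner.diff_right cinner.scaleR_left cinner.scaleR_right)

lemma A_J: "A (J x) = J (A x)"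
  by (simp add: A_simps AP)

lemma J_of_P: "P x = x \<Longrightarrow> J x = - x"
  by (simp add: scaleR_2)

lemma form_P_orthogonal: "A (P x) \<bullet> (y - P y) = 0" "A (y - P y) \<bullet> P x = 0"
proof -
  show *: "A (P x) \<bullet> (y - P y) = 0"
    using selfadjointD(3)[OF P, of "A x" "y - P y"] by (simp add: AP P_simps PP)
  show "A (y - P y) \<bullet> P x = 0"
    using * selfadjointD(3)[OF A, of "P x" "y - P y"] by (simp add: inner_commute)
qed

lemma form_split: "A x \<bullet> x = A (P x) \<bullet> P x + A (x - P x) \<bullet> (x - P x)"
proof -
  have "A (P x + (x - P x)) \<bullet> (P x + (x - P x)) = A (P x) \<bullet> P x + A (x - P x) \<bullet> (x - P x)"
    using form_P_orthogonal[of x x] unfolding A_simps(1) inner_add_left inner_add_right by linarith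
  then show ?thesis by simp
qed

lemma abs_form_split: "A (J x) \<bullet> x = - (A (P x) \<bullet> P x) + A (x - P x) \<bullet> (x - P x)"
proof -
  have "J x = (x - P x) - P x" by (simp add: scaleR_2)
  then have "A (J x) \<bullet> x = (A (x - P x) - A (P x)) \<bullet> (P x + (x - P x))"
    by (simp only: A_simps) simp
  also have "\<dots> = - (A (P x) \<bullet> P x) + A (x - P x) \<bullet> (x - P x)"
    using form_P_orthogonal[of x x] unfolding inner_add_right inner_diff_left by linarith
  finally show ?thesis .
qed

section \<open>The modulus and its root\<close>

lemma abs_ops: "A \<circ> J \<in> bounded_ops UNIV UNIV"
  by (rule bounded_ops_comp[OF selfadjointD(1)[OF A] J_ops])

lemma abs_nonneg: "nonneg_on UNIV (A \<circ> J)"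
  unfolding nonneg_on_UNIV_iff[OF abs_ops] positive_op_def symmetric_op_def
proof (intro conjI allI)
  show "bounded_linear (A \<circ> J)" using abs_ops bounded_ops_linear(1) by blast
  show "(A \<circ> J) x \<bullet> y = x \<bullet> (A \<circ> J) y" for x y
    using selfadjointD(3)[OF A, of "J x" y] selfadjointD(3)[OF J_selfadjoint, of x "A y"]
    by (simp only: comp_apply A_J)
  show "0 \<le> (A \<circ> J) x \<bullet> x" for x
    using abs_form_split[of x] negative[of "P x"] nonnegative[of "x - P x"] PP
    by (cases "P x = 0") (auto simp: P_simps A_simps)
qed

text \<open>\<open>A \<circ> J\<close> is nonnegative since \<open>J\<close> flips the sign of the
  form exactly on \<open>range P\<close>. Its square is \<open>A \<circ> A\<close> because
  \<open>J\<close> is an involution commuting with \<open>A\<close>, and a nonnegative root is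
  unique.\<close>

lemma op_abs_eq: "op_abs A = A \<circ> J"
  unfolding op_abs_def op_sqrt_def
proof (rule the1_equality[OF op_sqrt_unique(1)])
  show "A \<circ> A \<in> bounded_ops UNIV UNIV"
    using selfadjointD(1)[OF A] by (intro bounded_ops_comp)
  show "nonneg_on UNIV (A \<circ> A)"
    using selfadjointD(2)[OF A] by (simp add: nonneg_on_def cinner_same)
  show "A \<circ> J \<in> bounded_ops UNIV UNIV \<and> nonneg_on UNIV (A \<circ> J) \<and> (A \<circ> J) \<circ> (A \<circ> J) = A \<circ> A"
    using abs_ops abs_nonneg by (auto simp: fun_eq_iff A_J J_J)
qed

lemma R_ops: "R \<in> bounded_ops UNIV UNIV"
  and R_R: "R (R x) = A (J x)"
  and R_selfadjoint: "selfadjoint R"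
proof -
  note R = op_sqrt[OF abs_ops abs_nonneg, folded op_abs_eq]
  show "R \<in> bounded_ops UNIV UNIV" by (rule R)
  then show "selfadjoint R"
    using nonneg_on_symmetric[OF R(1,2)] by (simp add: selfadjoint_iff)
  show "R (R x) = A (J x)"
    using R(3) by (simp add: op_abs_eq fun_eq_iff)
qed

lemmas R_simps = bounded_ops_linear(2-)[OF R_ops]

lemma R_P: "R (P x) = P (R x)"
proof -
  have "P \<circ> (A \<circ> J) = (A \<circ> J) \<circ> P" by (auto simp: fun_eq_iff A_simps P_simps PP AP)
  then have "P \<circ> R = R \<circ> P"
    using op_sqrt_commute[OF abs_ops abs_nonneg] bounded_ops_linear(1)[OF selfadjointD(1)[OF P]]
    by (simp add: op_abs_eq)
  then show ?thesis by (metis comp_apply)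
qed

lemma R_J: "R (J x) = J (R x)"
  by (simp add: R_simps R_P)

lemma R_J_R: "R (J (R x)) = A x"
  by (simp only: R_J[symmetric] R_R J_J)

lemma norm_R: "(norm (R x))\<^sup>2 = A (J x) \<bullet> x"
  using selfadjointD(3)[OF R_selfadjoint, of "R x" x] by (simp add: power2_norm_eq_inner R_R)

lemma norm_R_P: "(norm (R (P x)))\<^sup>2 = - (A (P x) \<bullet> P x)"
  and norm_R_diff_P: "(norm (R (x - P x)))\<^sup>2 = A (x - P x) \<bullet> (x - P x)"
  using abs_form_split[of "P x"] abs_form_split[of "x - P x"]
  by (simp_all add: norm_R PP P_simps A_simps)

section \<open>The closed range and the sign operator\<close>

lemma csubspace_cran: "complex_vector.subspace (cran A)"
  by (rule csubspace_closure[OF bounded_ops_csubspace_range[OF selfadjointD(1)[OF A]]])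

text \<open>Testing with \<open>A (A k)\<close> gives \<open>A k = 0\<close>. Then \<open>A\<close>
  vanishes at \<open>P k\<close> too, where its form would be strictly negative unless
  \<open>P k = 0\<close>.\<close>

lemma orthogonal_cran:
  assumes "\<And>y. y \<in> cran A \<Longrightarrow> cinner y k = 0"
  shows "A k = 0" "P k = 0" "R k = 0"
proof -
  have "A (A k) \<in> cran A" using closure_subset[of "range A"] by auto
  then have "cinner (A k) (A k) = 0"
    using assms[of "A (A k)"] selfadjointD(2)[OF A, of "A k" k] by simp
  then show Ak: "A k = 0" by (simp add: cinner_same)
  have "A (P k) = 0" using Ak by (simp add: AP P_simps)
  then show "P k = 0" using negative[of "P k"] PP by fastforce
  then show "R k = 0" using norm_R[of k] Ak by simp
qed

text \<open>The component of \<open>x\<close> orthogonal to \<open>cran A\<close> lies in the common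
  kernel of \<open>A\<close>, \<open>P\<close> and \<open>R\<close>, so the premise makes it
  orthogonal to \<open>x\<close> and therefore zero. For values of the selfadjoint \<open>R\<close>
  and \<open>P\<close> the premise is immediate.\<close>

lemma mem_cranI:
  assumes "\<And>k. A k = 0 \<Longrightarrow> P k = 0 \<Longrightarrow> R k = 0 \<Longrightarrow> cinner x k = 0"
  shows "x \<in> cran A"
proof -
  obtain m where m: "m \<in> cran A" "\<And>y. y \<in> cran A \<Longrightarrow> cinner y (x - m) = 0"
    using orthogonal_decomposition[OF closed_closure csubspace_cran] by metis
  have "cinner x (x - m) = 0"
    using assms orthogonal_cran[OF m(2)] by blast
  then have "cinner (x - m) (x - m) = 0"
    using m by (simp add: cinner.diff_left)
  with m(1) show ?thesis by (simp add: cinner_same)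
qed

lemma R_mem_cran: "R x \<in> cran A"
  by (rule mem_cranI) (simp add: selfadjointD(2)[OF R_selfadjoint])

lemma P_mem_cran: "P x \<in> cran A"
  by (rule mem_cranI) (simp add: selfadjointD(2)[OF P])

lemma cran_R: "cran R = cran A"
proof
  show "cran R \<subseteq> cran A"
    using R_mem_cran by (intro closure_minimal) auto
  have "A x \<in> range R" for x using R_J_R[of x] by (metis rangeI)
  then show "cran A \<subseteq> cran R" by (intro closure_mono) auto
qed

lemma J_mem_cran: "x \<in> cran A \<Longrightarrow> J x \<in> cran A"
  by (intro complex_vector.subspace_diff[OF csubspace_cran])
    (auto intro: complex_vector.subspace_scale[OF csubspace_cran, of _ "of_real 2", unfolded scaleC_of_real] P_mem_cran)

lemma op_sgn_eq: "op_sgn A = restrict J (cran A)"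
  unfolding op_sgn_def
proof (rule the_equality)
  have ops: "restrict J (cran A) \<in> bounded_ops (cran A) (cran A)"
    using J_mem_cran bounded_ops_bound[OF J_ops] bounded_opsD(2,3)[OF J_ops] csubspace_cran
    unfolding bounded_ops_def
    by (auto simp: complex_vector.subspace_add complex_vector.subspace_scale) metis
  have polar: "restrict J (cran A) (op_abs A x) = A x" for x
  proof -
    have "A (J x) \<in> cran A" using closure_subset[of "range A"] by auto
    moreover have "J (A (J x)) = A x" by (simp only: A_J[symmetric] J_J)
    ultimately show ?thesis by (simp add: op_abs_eq)
  qed
  show "restrict J (cran A) \<in> bounded_ops (cran A) (cran A) \<and> A = restrict J (cran A) \<circ> op_abs A"
    by (intro conjI ops ext) (simp only: comp_apply polar)
  fix J' assume J': "J' \<in> bounded_ops (cran A) (cran A) \<and> A = J' \<circ> op_abs A"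
  show "J' = restrict J (cran A)"
  proof (rule bounded_ops_eqI[OF conjunct1[OF J'] ops csubspace_cran])
    show "range A \<subseteq> cran A" by (rule closure_subset)
    fix y assume "y \<in> range A"
    then obtain x where "y = A x" by blast
    \<comment> \<open>\<open>op_abs A\<close> reaches all of \<open>range A\<close>, so
      \<open>J'\<close> is prescribed on a dense subspace of \<open>cran A\<close>.\<close>
    then have "y = op_abs A (J x)" by (simp only: op_abs_eq comp_apply J_J)
    moreover have "J' (op_abs A (J x)) = A (J x)" using J' by (metis comp_apply)
    ultimately show "J' y = restrict J (cran A) y" by (simp only: polar)
  qed simp
qed

lemma op_sgn: "x \<in> cran A \<Longrightarrow> op_sgn A x = J x"
  by (simp add: op_sgn_eq)

end

section \<open>Equal negative indices\<close>

locale equal_index = A: negative_splitting A P + J2: negative_splitting J2 Q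
  for A P :: "'a::chilbert_space \<Rightarrow> 'a" and J2 Q :: "'b::chilbert_space \<Rightarrow> 'b" +
  assumes J2_J2: "J2 (J2 y) = y"
    and dim_eq: "cdimension (range P) = cdimension (range Q)"
    and dim_finite: "cdimension (range Q) < \<infinity>"
begin

text \<open>The vector \<open>Q y + J2 (Q y)\<close> is fixed by \<open>J2\<close> and lies in
  \<open>range Q\<close>, where the form is strictly negative, so it vanishes. Dually, with
  \<open>v = y - Q y\<close> the vector \<open>v - J2 v\<close> is reversed by \<open>J2\<close> and
  lies in the kernel of \<open>Q\<close>, where the form is nonnegative.\<close>

lemma J2_eq: "J2 y = y - 2 *\<^sub>R Q y"
proof -
  have neg: "J2 (Q y) = - Q y"
  proof -
    have "J2 (Q y + J2 (Q y)) = Q y + J2 (Q y)" by (simp add: J2.A_simps J2_J2)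
    moreover have "Q (Q y + J2 (Q y)) = Q y + J2 (Q y)"
      using J2.AP[of "Q y"] by (simp add: J2.P_simps J2.PP)
    ultimately have "Q y + J2 (Q y) = 0"
      using J2.negative[of "Q y + J2 (Q y)"] by (metis inner_ge_zero not_less)
    then show ?thesis by (simp add: add_eq_0_iff)
  qed
  have pos: "J2 (y - Q y) = y - Q y"
  proof -
    let ?v = "y - Q y"
    have "J2 (?v - J2 ?v) = - (?v - J2 ?v)" by (simp add: J2.A_simps J2_J2)
    moreover have "Q (?v - J2 ?v) = 0"
      using J2.AP[of ?v] by (simp add: J2.P_simps J2.PP J2.A_simps)
    ultimately have "?v - J2 ?v = 0"
      using J2.nonnegative[of "?v - J2 ?v"]
      by (metis inner_gt_zero_iff inner_minus_left neg_0_le_iff_le not_less)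
    then show ?thesis by simp
  qed
  have "J2 (Q y + (y - Q y)) = J2 (Q y) + J2 (y - Q y)" by (rule J2.A_simps)
  then show ?thesis by (simp add: neg pos scaleR_2)
qed

lemma Q_J2: "Q (J2 y) = - Q y"
  by (simp add: J2_eq J2.P_simps J2.PP scaleR_2)

text \<open>
  \<open>Q \<circ> T\<close> is injective on \<open>range P\<close>, hence onto \<open>range Q\<close> because the dimensions are
  equal and finite.
\<close>

lemma negative_part_onto:
  assumes T: "T \<in> bounded_ops UNIV UNIV"
    and neg: "\<And>x. P x = x \<Longrightarrow> x \<noteq> 0 \<Longrightarrow> J2 (T x) \<bullet> T x < 0"
  obtains l where "P l = l" "Q (T l) = Q y"
proof -
  let ?f = "Q \<circ> T"
  have "?f \<in> bounded_ops UNIV UNIV" by (rule bounded_ops_comp[OF selfadjointD(1)[OF J2.P] T])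
  note f = bounded_ops_linear[OF this]
  have "?f ` range P = range Q"
  proof (rule injective_image_eq_of_cdimension_eq)
    show "Vector_Spaces.linear scaleC scaleC ?f"
      using f by unfold_locales (auto simp: complex_vector.scale_right_distrib complex_vector.scale_left_distrib)
    show "complex_vector.subspace (range P)" "complex_vector.subspace (range Q)"
      using bounded_ops_csubspace_range selfadjointD(1) A.P J2.P by blast+
    show "?f ` range P \<subseteq> range Q" by auto
    fix x assume "x \<in> range P" "?f x = 0"
    \<comment> \<open>On the kernel of \<open>Q\<close> the operator \<open>J2\<close> is the
      identity, so its form is nonnegative there, against \<open>neg\<close>.\<close>
    then have "P x = x" "J2 (T x) = T x" using A.PP by (auto simp: J2_eq)
    then show "x = 0" using neg[of x] by (metis inner_ge_zero not_less)
  qed (rule dim_eq dim_finite)+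
  then obtain l where "l \<in> range P" "Q (T l) = Q y" by (metis comp_apply imageE rangeI)
  with that A.PP show thesis by blast
qed

lemma dominated_by_sqrt:
  assumes B: "B \<in> bounded_ops UNIV UNIV" and form: "\<And>x. J2 (B x) \<bullet> B x \<le> A x \<bullet> x"
  obtains K where "\<And>x. norm (B x) \<le> K * norm (A.R x)"
proof -
  obtain S where S: "finite S" "range P \<subseteq> complex_vector.span S"
    using cdimension_finiteD[of "range P"] dim_eq dim_finite by metis
  obtain S' where S': "finite S'" "complex_vector.span S \<subseteq> span S'"
    using cspan_finite_subset_span[OF S(1)] by blast
  have lin: "linear A.R" "linear B"
    using bounded_ops_linear(1)[OF A.R_ops] bounded_ops_linear(1)[OF B] bounded_linear.linear by blast+
  have "subspace (range P)"
    by (intro csubspace_imp_subspace bounded_ops_csubspace_range selfadjointD(1) A.P)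
  \<comment> \<open>On \<open>range P\<close> the squared norm of \<open>R x\<close> is
    \<open>- (A x, x)\<close>, which is positive unless \<open>x = 0\<close>.\<close>
  moreover have "x = 0" if "x \<in> range P" "A.R x = 0" for x
  proof -
    have Px: "P x = x" using that(1) A.PP by auto
    with that(2) A.norm_R_P[of x] have "A x \<bullet> x = 0" by simp
    with Px show ?thesis using A.negative[of x] by fastforce
  qed
  ultimately obtain K where K: "0 \<le> K" "\<And>x. x \<in> range P \<Longrightarrow> norm (B x) \<le> K * norm (A.R x)"
    using finite_dimensional_dominated[OF lin _ _ S'(1), of "range P"] S(2) S'(2) by blast
  show thesis
  proof
    fix x
    obtain l where l: "P l = l" "Q (B l) = Q (B x)"
    proof (rule negative_part_onto[OF B])
      show "J2 (B x) \<bullet> B x < 0" if "P x = x" "x \<noteq> 0" for x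
        using A.negative[OF that] form[of x] by linarith
    qed
    have le: "norm (A.R (P y)) \<le> norm (A.R y)" "norm (A.R (y - P y)) \<le> norm (A.R y)" for y
    proof -
      have "(norm (A.R y))\<^sup>2 = (norm (A.R (P y)))\<^sup>2 + (norm (A.R (y - P y)))\<^sup>2"
        using A.abs_form_split[of y] A.norm_R[of y] A.norm_R_P[of y] A.norm_R_diff_P[of y] by linarith
      moreover have "0 \<le> (norm (A.R (P y)))\<^sup>2" "0 \<le> (norm (A.R (y - P y)))\<^sup>2" by simp_all
      ultimately have "(norm (A.R (P y)))\<^sup>2 \<le> (norm (A.R y))\<^sup>2"
        "(norm (A.R (y - P y)))\<^sup>2 \<le> (norm (A.R y))\<^sup>2" by linarith+
      then show "norm (A.R (P y)) \<le> norm (A.R y)" "norm (A.R (y - P y)) \<le> norm (A.R y)"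
        by (auto intro: power2_le_imp_le)
    qed
    let ?z = "B (x - l)" and ?v = "x - P x" and ?u = "P x - l"
    have "Q ?z = 0" using l by (simp add: bounded_ops_linear(3)[OF B] J2.P_simps)
    then have "(norm ?z)\<^sup>2 = J2 ?z \<bullet> ?z" by (simp add: J2_eq power2_norm_eq_inner)
    also have "\<dots> \<le> A (x - l) \<bullet> (x - l)" by (rule form)
    also have "\<dots> = (norm (A.R ?v))\<^sup>2 - (norm (A.R ?u))\<^sup>2"
      using A.form_split[of "x - l"] A.norm_R_P[of "x - l"] A.norm_R_diff_P[of "x - l"] l(1)
      by (simp add: A.P_simps)
    \<comment> \<open>The estimate is used twice: it bounds \<open>?z\<close>, and it bounds
      \<open>A.R ?u\<close> and through it \<open>A.R l\<close> by \<open>2 * norm (A.R x)\<close>.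
      With \<open>K\<close> on \<open>range P\<close> this gives the constant
      \<open>1 + 2 * K\<close>.\<close>
    finally have "(norm ?z)\<^sup>2 + (norm (A.R ?u))\<^sup>2 \<le> (norm (A.R ?v))\<^sup>2" by simp
    moreover have "0 \<le> (norm ?z)\<^sup>2" "0 \<le> (norm (A.R ?u))\<^sup>2" by simp_all
    ultimately have "(norm ?z)\<^sup>2 \<le> (norm (A.R ?v))\<^sup>2" "(norm (A.R ?u))\<^sup>2 \<le> (norm (A.R ?v))\<^sup>2"
      by linarith+
    then have zu: "norm ?z \<le> norm (A.R x)" "norm (A.R ?u) \<le> norm (A.R x)"
      using le(2)[of x] by (meson order_trans power2_le_imp_le norm_ge_zero)+
    have "norm (A.R l) \<le> norm (A.R (P x)) + norm (A.R ?u)"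
      using norm_triangle_ineq4[of "A.R (P x)" "A.R ?u"] by (simp add: A.R_simps)
    with zu(2) le(1)[of x] have "norm (A.R l) \<le> 2 * norm (A.R x)" by linarith
    then have "K * norm (A.R l) \<le> K * (2 * norm (A.R x))" using K(1) by (rule mult_left_mono)
    moreover have "norm (B l) \<le> K * norm (A.R l)" using K(2) l(1) by (metis rangeI)
    moreover have "norm (B x) \<le> norm ?z + norm (B l)"
      using norm_triangle_ineq[of ?z "B l"] by (simp add: bounded_ops_linear(3)[OF B])
    ultimately show "norm (B x) \<le> (1 + 2 * K) * norm (A.R x)"
      using zu(1) by (simp add: algebra_simps)
  qed
qed

section \<open>Contractive factors and their forms\<close>

lemma nonneg_form_iff:
  assumes B: "B \<in> bounded_ops UNIV UNIV"
  shows "nonneg_on UNIV (\<lambda>x. A x - cadjoint B (J2 (B x))) \<longleftrightarrow> (\<forall>x. J2 (B x) \<bullet> B x \<le> A x \<bullet> x)"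
  by (simp add: nonneg_on_def cinner.diff_left cadjoint(2)[OF B] selfadjointD(4)[OF A.A]
      selfadjointD(4)[OF J2.A] flip: of_real_diff)

lemma J_contractive_iff:
  "J_contractive (cran A) (op_sgn A) J2 C \<longleftrightarrow>
     C \<in> bounded_ops (cran A) UNIV \<and> (\<forall>m\<in>cran A. J2 (C m) \<bullet> C m \<le> A.J m \<bullet> m)"
proof (cases "C \<in> bounded_ops (cran A) UNIV")
  case True
  have "cinner (op_sgn A m - cadjoint_on (cran A) C (J2 (C m))) m =
      of_real (A.J m \<bullet> m - J2 (C m) \<bullet> C m)" if "m \<in> cran A" for m
    using that selfadjointD(4)[OF A.J_selfadjoint, of m] selfadjointD(4)[OF J2.A, of "C m"]
      cadjoint_on(3)[OF closed_closure A.csubspace_cran True]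
    by (simp only: A.op_sgn cinner.diff_left of_real_diff)
  with True show ?thesis by (simp add: J_contractive_def nonneg_on_def del: of_real_diff)
qed (simp add: J_contractive_def)

lemma J_isometric_iff:
  "J_isometric (cran A) (op_sgn A) J2 C \<longleftrightarrow> C \<in> bounded_ops (cran A) UNIV \<and>
     (\<forall>m\<in>cran A. \<forall>m'\<in>cran A. cinner (C m') (J2 (C m)) = cinner m' (A.J m))"
proof (cases "C \<in> bounded_ops (cran A) UNIV")
  case True
  have "cadjoint_on (cran A) C (J2 (C m)) = op_sgn A m \<longleftrightarrow>
      (\<forall>m'\<in>cran A. cinner (C m') (J2 (C m)) = cinner m' (A.J m))" if "m \<in> cran A" for m
    using cadjoint_on_eqI[OF A.csubspace_cran A.J_mem_cran[OF that], of C "J2 (C m)"] A.op_sgn[OF that]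
      cadjoint_on(2)[OF closed_closure A.csubspace_cran True] by metis
  with True show ?thesis by (simp add: J_isometric_def)
qed (simp add: J_isometric_def)

lemma J_isometric_imp_J_contractive:
  "J_isometric (cran A) (op_sgn A) J2 C \<Longrightarrow> J_contractive (cran A) (op_sgn A) J2 C"
  unfolding J_isometric_iff J_contractive_iff
  by (metis cinner_commute inner_eq_Re_cinner inner_commute order_refl)

lemma factor_unique:
  assumes "C \<in> bounded_ops (cran A) UNIV" "C' \<in> bounded_ops (cran A) UNIV" "C \<circ> A.R = C' \<circ> A.R"
  shows "C = C'"
proof (rule bounded_ops_eqI[OF assms(1,2) A.csubspace_cran])
  show "range A.R \<subseteq> cran A" using A.R_mem_cran by blast
  show "C y = C' y" if "y \<in> range A.R" for y
    using that assms(3) by (metis comp_apply rangeE)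
qed (simp add: A.cran_R)

text \<open>Serves three purposes by the choice of \<open>U\<close>: inequalities with
  \<open>{0..}\<close>, identities with \<open>{0}\<close>, and membership in
  \<open>cran B\<close>.\<close>

lemma dense_closed:
  assumes "continuous_on (cran A) f" "closed U" "\<And>x. f (A.R x) \<in> U" "m \<in> cran A"
  shows "f m \<in> U"
proof -
  have "f ` closure (range A.R) \<subseteq> U"
    by (rule image_closure_subset) (use assms A.cran_R in auto)
  with assms(4) A.cran_R show ?thesis by blast
qed

lemma continuous_on_comp_op:
  assumes "T \<in> bounded_ops UNIV UNIV" "continuous_on M f"
  shows "continuous_on M (\<lambda>x. T (f x))"
  by (rule bounded_linear.continuous_on[OF bounded_ops_linear(1)[OF assms(1)] assms(2)])

lemma J_contractive_factor:
  assumes B: "B \<in> bounded_ops UNIV UNIV" and form: "\<And>x. J2 (B x) \<bullet> B x \<le> A x \<bullet> x"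
  obtains C where "J_contractive (cran A) (op_sgn A) J2 C" "B = C \<circ> A.R"
proof -
  obtain K where "\<And>x. norm (B x) \<le> K * norm (A.R x)"
    using dominated_by_sqrt[OF B form] by blast
  then obtain C where C: "C \<in> bounded_ops (cran A) UNIV" "B = C \<circ> A.R"
    using factor_through_dense_range[OF A.R_ops B] A.cran_R by metis
  have "A.J m \<bullet> m - J2 (C m) \<bullet> C m \<in> {0..}" if "m \<in> cran A" for m
  proof (rule dense_closed[OF _ _ _ that])
    show "continuous_on (cran A) (\<lambda>m. A.J m \<bullet> m - J2 (C m) \<bullet> C m)"
      by (intro continuous_on_diff continuous_on_inner continuous_on_id
          continuous_on_comp_op[OF A.J_ops] continuous_on_comp_op[OF selfadjointD(1)[OF J2.A]]
          bounded_ops_continuous_on[OF C(1) A.csubspace_cran])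
    show "A.J (A.R x) \<bullet> A.R x - J2 (C (A.R x)) \<bullet> C (A.R x) \<in> {0..}" for x
    proof -
      have "A.J (A.R x) \<bullet> A.R x = A x \<bullet> x"
        using selfadjointD(3)[OF A.R_selfadjoint, of "A.J (A.R x)" x] A.R_J_R[of x] by simp
      with form[of x] C(2) show ?thesis by simp
    qed
  qed simp
  with C(1) have "J_contractive (cran A) (op_sgn A) J2 C" by (simp add: J_contractive_iff)
  from this C(2) show thesis by (rule that)
qed

lemma J_contractive_form:
  assumes "J_contractive (cran A) (op_sgn A) J2 C" "B = C \<circ> A.R"
  shows "J2 (B x) \<bullet> B x \<le> A x \<bullet> x"
proof -
  have "J2 (C (A.R x)) \<bullet> C (A.R x) \<le> A.J (A.R x) \<bullet> A.R x"
    using assms(1) A.R_mem_cran unfolding J_contractive_iff by blast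
  also have "\<dots> = A x \<bullet> x"
    using selfadjointD(3)[OF A.R_selfadjoint, of "A.J (A.R x)" x] A.R_J_R[of x] by simp
  finally show ?thesis by (simp add: assms(2))
qed

text \<open>
  For \<open>m\<close> in \<open>cran A\<close> complete squares in
  \<open>q m y = (J m, m) + 2 Re (C m, y) + (J2 y, y)\<close> with respect to \<open>m\<close> and to \<open>y\<close>; this is
  the Schur complement argument for the block operator \<open>[[J, C*], [C, J2]]\<close>.
\<close>

lemma J_contractive_imp_J_bicontractive:
  assumes con: "J_contractive (cran A) (op_sgn A) J2 C"
  shows "J_bicontractive (cran A) (op_sgn A) J2 C"
proof -
  have C: "C \<in> bounded_ops (cran A) UNIV"
    and form: "\<And>m. m \<in> cran A \<Longrightarrow> J2 (C m) \<bullet> C m \<le> A.J m \<bullet> m"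
    using con by (auto simp: J_contractive_iff)
  note adj = cadjoint_on[OF closed_closure A.csubspace_cran C]
  \<comment> \<open>\<open>C\<close> lives on \<open>cran A\<close> only, which contains
    \<open>range P\<close>; composing with \<open>P\<close> gives an everywhere defined operator
    that \<open>negative_part_onto\<close> accepts.\<close>
  have CP: "C \<circ> P \<in> bounded_ops UNIV UNIV"
  proof (rule bounded_ops_UNIV_I)
    obtain K where K: "\<And>x. x \<in> cran A \<Longrightarrow> norm (C x) \<le> norm x * K" "0 < K"
      using bounded_ops_bound[OF C] by metis
    obtain K' where K': "\<And>x. norm (P x) \<le> norm x * K'"
      using bounded_ops_bound[OF selfadjointD(1)[OF A.P]] by (metis UNIV_I)
    show "bounded_linear (C \<circ> P)"
    proof (rule bounded_linear_intro)
      show "norm ((C \<circ> P) x) \<le> norm x * (K' * K)" for x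
        using order_trans[OF K(1)[OF A.P_mem_cran[of x]] mult_right_mono[OF K'[of x]]] K(2)
        by (simp add: mult.assoc)
    qed (simp_all add: A.P_simps bounded_opsD[OF C] A.P_mem_cran)
    show "(C \<circ> P) (c *\<^sub>C x) = c *\<^sub>C (C \<circ> P) x" for c x
      by (simp add: A.P_simps bounded_opsD[OF C] A.P_mem_cran)
  qed
  have "A.J (cadjoint_on (cran A) C y) \<bullet> cadjoint_on (cran A) C y \<le> J2 y \<bullet> y" for y
  proof -
    define a where "a = cadjoint_on (cran A) C y"
    define b where "b = A.J a"
    have a: "a \<in> cran A" and b: "b \<in> cran A" and Jb: "A.J b = a"
      using adj(1) A.J_mem_cran A.J_J by (auto simp: a_def b_def)
    \<comment> \<open>The target \<open>y + C b\<close> is chosen so that \<open>Q w = 0\<close> for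
      the \<open>w\<close> below, using \<open>Q J2 = - Q\<close>.\<close>
    obtain l where l: "P l = l" "Q ((C \<circ> P) l) = Q (y + C b)"
    proof (rule negative_part_onto[OF CP])
      fix x assume x: "P x = x" "x \<noteq> 0"
      have "J2 (C x) \<bullet> C x \<le> A.J x \<bullet> x" using form A.P_mem_cran x(1) by metis
      also have "\<dots> = - (x \<bullet> x)" by (simp only: A.J_of_P[OF x(1)] inner_minus_left)
      also have "\<dots> < 0" using x(2) by simp
      finally show "J2 ((C \<circ> P) x) \<bullet> (C \<circ> P) x < 0" using x(1) by simp
    qed
    have l_cran: "l \<in> cran A" using A.P_mem_cran l(1) by metis
    \<comment> \<open>By \<open>Jb\<close> the vector \<open>- b\<close> is the critical point of
      \<open>q\<close> in \<open>m\<close>. As \<open>J\<close> is \<open>-1\<close> at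
      \<open>l\<close>, moving away from it by \<open>l\<close> changes \<open>q\<close> by
      \<open>- (l \<bullet> l)\<close>, which has the right sign.\<close>
    define m where "m = l - b"
    have m: "m \<in> cran A" unfolding m_def
      by (rule complex_vector.subspace_diff[OF A.csubspace_cran l_cran b])
    have Cm: "C m = C l - C b"
      unfolding m_def by (rule bounded_ops_diff[OF C A.csubspace_cran l_cran b])
    \<comment> \<open>\<open>(J2 w, w)\<close> is \<open>q m y\<close> with \<open>(J m, m)\<close>
      replaced by \<open>(J2 C m, C m)\<close>, which is no larger.\<close>
    define w where "w = y + J2 (C m)"
    have "Q w = 0"
      using l by (simp add: w_def Cm J2.P_simps Q_J2)
    then have "0 \<le> J2 w \<bullet> w" by (rule J2.nonnegative)
    also have "\<dots> = J2 y \<bullet> y + 2 * (C m \<bullet> y) + J2 (C m) \<bullet> C m"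
      using selfadjointD(3)[OF J2.A, of y "J2 (C m)"]
      by (simp add: w_def J2.A_simps J2_J2 inner_simps inner_commute)
    also have "C m \<bullet> y = m \<bullet> a"
      using adj(2)[OF m, of y] by (simp add: inner_eq_Re_cinner a_def)
    also have "J2 (C m) \<bullet> C m \<le> A.J m \<bullet> m" by (rule form[OF m])
    also have "A.J m \<bullet> m = - (l \<bullet> l) - 2 * (l \<bullet> a) + a \<bullet> b"
    proof -
      have "A.J m = - l - a"
        unfolding m_def by (simp only: bounded_ops_linear(3)[OF A.J_ops] A.J_of_P[OF l(1)] Jb)
      moreover have "l \<bullet> b = - (l \<bullet> a)"
        using selfadjointD(3)[OF A.J_selfadjoint, of l a]
        by (simp only: A.J_of_P[OF l(1)] b_def[symmetric] inner_minus_left)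
      ultimately show ?thesis by (simp add: m_def inner_simps inner_commute)
    qed
    finally have "0 \<le> J2 y \<bullet> y - l \<bullet> l - a \<bullet> b"
      by (simp add: m_def inner_simps inner_commute)
    then have "b \<bullet> a \<le> J2 y \<bullet> y"
      using inner_ge_zero[of l] inner_commute[of a b] by linarith
    then show ?thesis by (simp only: a_def b_def)
  qed
  moreover have "cinner (J2 y - C (op_sgn A (cadjoint_on (cran A) C y))) y =
      of_real (J2 y \<bullet> y - A.J (cadjoint_on (cran A) C y) \<bullet> cadjoint_on (cran A) C y)" for y
    using adj(2)[OF A.J_mem_cran[OF adj(1)], of y y] selfadjointD(4)[OF J2.A]
      selfadjointD(4)[OF A.J_selfadjoint, of "cadjoint_on (cran A) C y"]
    by (simp only: A.op_sgn[OF adj(1)] cinner.diff_left of_real_diff)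
  ultimately have "nonneg_on UNIV (\<lambda>y. J2 y - C (op_sgn A (cadjoint_on (cran A) C y)))"
    by (simp add: nonneg_on_def del: of_real_diff)
  with con show ?thesis by (simp add: J_bicontractive_def)
qed

section \<open>The isometric case\<close>

lemma eq_form_iff:
  assumes B: "B \<in> bounded_ops UNIV UNIV"
  shows "A = cadjoint B \<circ> J2 \<circ> B \<longleftrightarrow> (\<forall>x x'. cinner (B x') (J2 (B x)) = cinner x' (A x))"
proof
  assume "A = cadjoint B \<circ> J2 \<circ> B"
  then have "A x = cadjoint B (J2 (B x))" for x by (metis comp_apply)
  then show "\<forall>x x'. cinner (B x') (J2 (B x)) = cinner x' (A x)"
    by (simp only: cadjoint(1)[OF B]) simp
next
  assume "\<forall>x x'. cinner (B x') (J2 (B x)) = cinner x' (A x)"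
  then have "cadjoint B (J2 (B x)) = A x" for x
    by (intro cadjoint_on_eqI[OF complex_vector.subspace_UNIV]) auto
  then show "A = cadjoint B \<circ> J2 \<circ> B" by (simp only: fun_eq_iff comp_apply simp_thms)
qed

lemma J_isometric_factor_iff:
  assumes B: "B \<in> bounded_ops UNIV UNIV" and C: "C \<in> bounded_ops (cran A) UNIV" "B = C \<circ> A.R"
  shows "A = cadjoint B \<circ> J2 \<circ> B \<longleftrightarrow> J_isometric (cran A) (op_sgn A) J2 C"
proof -
  have JR: "cinner (A.R x') (A.J (A.R x)) = cinner x' (A x)" for x x'
    using selfadjointD(2)[OF A.R_selfadjoint, of x' "A.J (A.R x)"] A.R_J_R[of x] by simp
  have contC: "continuous_on (cran A) C"
    by (rule bounded_ops_continuous_on[OF C(1) A.csubspace_cran])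
  note ct = continuous_on_diff cinner.continuous_on continuous_on_const continuous_on_id contC
    continuous_on_comp_op[OF A.J_ops] continuous_on_comp_op[OF selfadjointD(1)[OF J2.A]]
  show ?thesis
    unfolding eq_form_iff[OF B] J_isometric_iff
  proof (intro iffI conjI C(1) ballI allI)
    assume eq: "\<forall>x x'. cinner (B x') (J2 (B x)) = cinner x' (A x)"
    fix m m' assume m: "m \<in> cran A" and m': "m' \<in> cran A"
    \<comment> \<open>Density is used in one variable at a time: first in \<open>m\<close> with the
      other argument in \<open>range R\<close>, then in \<open>m'\<close>.\<close>
    have left: "cinner (C (A.R x')) (J2 (C m)) - cinner (A.R x') (A.J m) \<in> {0}" for x'
    proof (rule dense_closed[OF _ _ _ m])
      show "continuous_on (cran A) (\<lambda>m. cinner (C (A.R x')) (J2 (C m)) - cinner (A.R x') (A.J m))"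
        by (intro ct)
      show "cinner (C (A.R x')) (J2 (C (A.R x))) - cinner (A.R x') (A.J (A.R x)) \<in> {0}" for x
        using eq C(2) JR[of x' x] by simp
    qed simp
    have "cinner (C m') (J2 (C m)) - cinner m' (A.J m) \<in> {0}"
    proof (rule dense_closed[OF _ _ _ m'])
      show "continuous_on (cran A) (\<lambda>m'. cinner (C m') (J2 (C m)) - cinner m' (A.J m))"
        by (intro ct)
    qed (use left in simp_all)
    then show "cinner (C m') (J2 (C m)) = cinner m' (A.J m)" by simp
  next
    assume "C \<in> bounded_ops (cran A) UNIV \<and>
      (\<forall>m\<in>cran A. \<forall>m'\<in>cran A. cinner (C m') (J2 (C m)) = cinner m' (A.J m))"
    then show "cinner (B x') (J2 (B x)) = cinner x' (A x)" for x x'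
      using A.R_mem_cran JR[of x' x] C(2) by simp
  qed
qed

text \<open>A unitary \<open>C\<close> is onto, and its values lie in \<open>cran B\<close> because
  \<open>range R\<close> is dense in \<open>cran A\<close>. Conversely, isometry makes the defect
  \<open>d\<close> of the second unitarity identity orthogonal to every \<open>J2 (C m)\<close>, so
  \<open>J2 d\<close> is orthogonal to the dense \<open>range B\<close>.\<close>

lemma J_unitary_iff_dense_range:
  assumes iso: "J_isometric (cran A) (op_sgn A) J2 C" and B: "B = C \<circ> A.R"
  shows "J_unitary (cran A) (op_sgn A) J2 C \<longleftrightarrow> cran B = UNIV"
proof -
  have C: "C \<in> bounded_ops (cran A) UNIV"
    and isoC: "\<And>m m'. m \<in> cran A \<Longrightarrow> m' \<in> cran A \<Longrightarrow> cinner (C m') (J2 (C m)) = cinner m' (A.J m)"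
    using iso by (auto simp: J_isometric_iff)
  note adj = cadjoint_on[OF closed_closure A.csubspace_cran C]
  have uni: "J_unitary (cran A) (op_sgn A) J2 C \<longleftrightarrow>
      (\<forall>y. C (A.J (cadjoint_on (cran A) C y)) = J2 y)"
    using iso by (simp add: J_unitary_def A.op_sgn[OF adj(1)])
  have contC: "continuous_on (cran A) C"
    by (rule bounded_ops_continuous_on[OF C A.csubspace_cran])
  show ?thesis unfolding uni
  proof
    assume u: "\<forall>y. C (A.J (cadjoint_on (cran A) C y)) = J2 y"
    have "y \<in> cran B" for y
    proof -
      have "C (A.J (cadjoint_on (cran A) C (J2 y))) = y" using u J2_J2 by simp
      moreover have "C (A.J (cadjoint_on (cran A) C (J2 y))) \<in> cran B"
      proof (rule dense_closed[OF contC closed_closure])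
        show "C (A.R x) \<in> cran B" for x
          using closure_subset[of "range B"] by (auto simp: B)
      qed (rule A.J_mem_cran[OF adj(1)])
      ultimately show ?thesis by simp
    qed
    then show "cran B = UNIV" by auto
  next
    assume dense: "cran B = UNIV"
    show "\<forall>y. C (A.J (cadjoint_on (cran A) C y)) = J2 y"
    proof
      fix y
      define d where "d = C (A.J (cadjoint_on (cran A) C y)) - J2 y"
      have orth: "cinner d (J2 (C m)) = 0" if m: "m \<in> cran A" for m
      proof -
        let ?a = "cadjoint_on (cran A) C y"
        have "cinner (C (A.J ?a)) (J2 (C m)) = cinner (A.J ?a) (A.J m)"
          by (rule isoC[OF m A.J_mem_cran[OF adj(1)]])
        also have "\<dots> = cinner ?a m"
          using selfadjointD(2)[OF A.J_selfadjoint, of ?a "A.J m"] A.J_J[of m] by simp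
        also have "\<dots> = cinner y (C m)" by (rule adj(3)[OF m])
        also have "\<dots> = cinner (J2 y) (J2 (C m))"
          using selfadjointD(2)[OF J2.A, of y "J2 (C m)"] J2_J2 by simp
        finally show ?thesis by (simp add: d_def cinner.diff_left)
      qed
      have "cinner (J2 d) ` closure (range B) \<subseteq> {0}"
      proof (rule image_closure_subset)
        show "continuous_on (closure (range B)) (cinner (J2 d))"
          by (intro cinner.continuous_on continuous_on_const continuous_on_id)
        show "cinner (J2 d) ` range B \<subseteq> {0}"
          using orth A.R_mem_cran selfadjointD(2)[OF J2.A] by (auto simp: B)
      qed simp
      then have "cinner (J2 d) (J2 d) = 0" using dense by auto
      then have "J2 d = 0" by (simp add: cinner_same)
      then have "d = 0" using J2_J2[of d] by (simp add: J2.A_simps)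
      then show "C (A.J (cadjoint_on (cran A) C y)) = J2 y" by (simp add: d_def)
    qed
  qed
qed

end

lemma equal_index_exists:
  assumes "selfadjoint A" "selfadjoint J2" "J2 \<circ> J2 = id" "nu_minus A = nu_minus J2" "nu_minus J2 < \<infinity>"
  obtains P Q where "equal_index A P J2 Q"
proof -
  obtain P where P: "negative_splitting A P" "cdimension (range P) = nu_minus A"
    using negative_splitting_exists assms by metis
  obtain Q where Q: "negative_splitting J2 Q" "cdimension (range Q) = nu_minus J2"
    using negative_splitting_exists assms by metis
  have "equal_index A P J2 Q"
    using P Q assms by (simp add: equal_index_def equal_index_axioms_def fun_eq_iff)
  then show thesis by (rule that)
qed

theorem proposition3p3:
  fixes A :: "'a::chilbert_space \<Rightarrow> 'a"
    and B :: "'a \<Rightarrow> 'b::chilbert_space"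
    and J2 :: "'b \<Rightarrow> 'b"
  assumes "selfadjoint A"
    and "B \<in> bounded_ops UNIV UNIV"
    and "selfadjoint J2" and "J2 \<circ> J2 = id"
    and "nu_minus A = nu_minus J2" and "nu_minus J2 < \<infinity>"
  shows
    "(nonneg_on UNIV (\<lambda>x. A x - cadjoint B (J2 (B x))) \<longleftrightarrow>
        (\<exists>C. J_contractive (cran A) (op_sgn A) J2 C \<and> B = C \<circ> op_sqrt (op_abs A))) \<and>
     (nonneg_on UNIV (\<lambda>x. A x - cadjoint B (J2 (B x))) \<longrightarrow>
        (\<exists>!C. J_contractive (cran A) (op_sgn A) J2 C \<and> B = C \<circ> op_sqrt (op_abs A)) \<and>
        (\<forall>C. J_contractive (cran A) (op_sgn A) J2 C \<and> B = C \<circ> op_sqrt (op_abs A) \<longrightarrow>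
           J_bicontractive (cran A) (op_sgn A) J2 C)) \<and>
     (A = cadjoint B \<circ> J2 \<circ> B \<longleftrightarrow>
        (\<exists>C. J_isometric (cran A) (op_sgn A) J2 C \<and> B = C \<circ> op_sqrt (op_abs A))) \<and>
     (A = cadjoint B \<circ> J2 \<circ> B \<longrightarrow>
        (\<exists>!C. J_isometric (cran A) (op_sgn A) J2 C \<and> B = C \<circ> op_sqrt (op_abs A)) \<and>
        (\<forall>C. J_isometric (cran A) (op_sgn A) J2 C \<and> B = C \<circ> op_sqrt (op_abs A) \<longrightarrow>
           (J_unitary (cran A) (op_sgn A) J2 C \<longleftrightarrow> cran B = UNIV)))"
proof -
  obtain P Q where "equal_index A P J2 Q"
    using equal_index_exists assms by metis
  then interpret equal_index A P J2 Q .
  let ?con = "\<lambda>C. J_contractive (cran A) (op_sgn A) J2 C \<and> B = C \<circ> op_sqrt (op_abs A)"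
    and ?iso = "\<lambda>C. J_isometric (cran A) (op_sgn A) J2 C \<and> B = C \<circ> op_sqrt (op_abs A)"
    and ?ineq = "nonneg_on UNIV (\<lambda>x. A x - cadjoint B (J2 (B x)))"
    and ?eq = "A = cadjoint B \<circ> J2 \<circ> B"
  note B = assms(2)
  have contr_ex: "?ineq \<longleftrightarrow> (\<exists>C. ?con C)"
    unfolding nonneg_form_iff[OF B] using J_contractive_factor[OF B] J_contractive_form by metis
  have iso_con: "?iso C \<Longrightarrow> ?con C" for C using J_isometric_imp_J_contractive by blast
  have unique: "?con C \<Longrightarrow> ?con C' \<Longrightarrow> C = C'" for C C'
    using factor_unique[of C C'] by (auto simp: J_contractive_iff)
  \<comment> \<open>A contractive factor is isometric exactly when equality holds. As equality
    implies the inequality, existence and uniqueness in (ii) are inherited from (i).\<close>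
  have iso_iff: "?con C \<Longrightarrow> ?eq \<longleftrightarrow> ?iso C" for C
    using J_isometric_factor_iff[OF B, of C] by (auto simp: J_contractive_iff)
  have "?eq \<Longrightarrow> ?ineq"
    unfolding nonneg_form_iff[OF B] eq_form_iff[OF B]
    by (metis cinner_commute inner_commute inner_eq_Re_cinner order_refl)
  then have iso_ex: "?eq \<longleftrightarrow> (\<exists>C. ?iso C)"
    using contr_ex iso_iff iso_con by blast
  show ?thesis
  proof (intro conjI impI allI)
    show "\<exists>!C. ?con C" if ?ineq using that contr_ex unique by blast
    show "\<exists>!C. ?iso C" if ?eq using that iso_ex unique iso_con by blast
  qed (use contr_ex iso_ex J_contractive_imp_J_bicontractive J_unitary_iff_dense_range in blast)+
qed

end
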